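(* Given $\lambda\in\mathbb{R}$, consider on $\mathbb{R}^4$ the control-affine system $$\dot x_1=u,\qquad \dot x_2=x_1,\qquad \dot x_3=x_2,\qquad \dot x_4=x_1^2x_3^2-\lambda x_2^4,$$ that is $\dot x=f_0(x)+uf_1(x)$ with $f_0(x)=(0,x_1,x_2,x_1^2x_3^2-\lambda x_2^4)$ and $f_1(x)=e_1$. There exists $\lambda^*>0$ such that this system (i) is not $W^{-1,\infty}$-STLC when $\lambda\le\lambda^*$; (ii) is smoothly-STLC when $\lambda>\lambda^*$. Moreover, in $\mathcal{B}^\star$, the only basis brackets whose evaluations at $0$ may be nonzero are: $f_{X_1}(0)=e_1$, $f_{M_1}(0)=e_2$, $f_{M_2}(0)=e_3$, $f_{Q_{1,3,3}}(0)=4e_4$ and $f_{Q_{2,2,2}}(0)=-24\lambda e_4$.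
   Context: Brackets. $X=\{X_0,X_1\}$ are non-commutative indeterminates, $\mathrm{Br}(X)$ is the free magma over $X$ (formal iterated brackets $(a,b)$); for $b=(b_1,b_2)$, $\lambda(b):=b_1$, $\mu(b):=b_2$; $n_1(b)$ is the number of occurrences of $X_1$ in $b$. $[f,g]:=(Dg)f-(Df)g$; $f_b$ is obtained from $b$ by replacing $X_0,X_1$ by $f_0,f_1$ and evaluating Lie brackets. $b0^\nu:=((\cdots(b,X_0),\ldots),X_0)$ with $\nu$ copies of $X_0$ added. The set $\mathcal{B}^\star$. Let $G\subset\mathrm{Br}(X)$ be the smallest subset with $X_0,X_1\in G$ and $(a,b)\in G$ whenever $a,b\in G$, $a\ne X_0$. Each $b\in G\setminus\{X_0\}$ is uniquely $b=b^*0^{\nu_b}$ with $\nu_b\in\mathbb{N}$ and $b^*$ (the germ) equal to $X_1$ or of the form $(b_1,b_2)$ with $b_1,b_2\neq X_0$. Order $G$ totally by: $X_0$ is maximal; for $a,b\in G\setminus\{X_0\}$, $a<b$ iff $a^*<b^*$ or ($a^*=b^*$ and $\nu_a<\nu_b$); for germs, $a^*<b^*$ iff $n_1(a^* )<n_1(b^* )$, or these are equal and $\lambda(a^* )<\lambda(b^* )$, or both are equal and $\mu(a^* )<\mu(b^* )$. $\mathcal{B}^\star\subset G$ is the unique Hall set for this order: $X\subset\mathcal{B}^\star$ and $(b_1,b_2)\in\mathcal{B}^\star$ iff $b_1,b_2\in\mathcal{B}^\star$, $b_1<b_2$, and ($b_2\in X$ or $\lambda(b_2)\le b_1$). Named elements: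 $M_\nu:=X_10^\nu$, $W_j:=(M_{j-1},M_j)$, $P_{j,k}:=(M_{k-1},W_j)$, $Q_{j,k,l}:=(M_{l-1},P_{j,k})$. Controllability. For $u\in L^1(0,T)$, $x(\cdot;u)$ is the solution with $x(0)=0$, and $u_1(t)=\int_0^tu$. For $m\in\mathbb{N}$, $W^{m,\infty}(0,T)$ has norm $\|u\|_{L^\infty}+\dots+\|u^{(m)}\|_{L^\infty}$ and $W^{m,\infty}_0(0,T)$ is its subspace of functions vanishing at $0$ and $T$ with their derivatives up to order $m-1$; $W^{-1,\infty}(0,T):=L^1(0,T)$ with norm $\|u\|_{W^{-1,\infty}}:=\|u_1\|_{L^\infty}$. The system is $W^{m,\infty}$-STLC (resp. $W^{m,\infty}_0$-STLC) when for all $T,\rho>0$ there is $\delta>0$ such that for all $x^\star\in B(0,\delta)$ there is $u\in W^{m,\infty}(0,T)$ (resp. $W^{m,\infty}_0(0,T)$) with $x(T;u)=x^\star$ and $\|u\|_{W^{m,\infty}}\le\rho$. It is smoothly-STLC when it is $W^{m,\infty}_0$-STLC for all $m\in\mathbb{N}$. *)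

theory Defs
  imports "HOL-Analysis.Analysis" "HOL-Probability.Essential_Supremum"
begin

section \<open>Formal brackets\<close>

text \<open>The free magma over \<open>{X\<^sub>0, X\<^sub>1}\<close>; \<open>Br a b\<close> is the formal bracket \<open>(a, b)\<close>, whose left and
  right factors are \<open>\<lambda>(Br a b) = a\<close> and \<open>\<mu>(Br a b) = b\<close>.\<close>

datatype br = X0 | X1 | Br br br

primrec n1 :: "br \<Rightarrow> nat" where
  "n1 X0 = 0"
| "n1 X1 = 1"
| "n1 (Br a b) = n1 a + n1 b"

definition br0 :: "br \<Rightarrow> nat \<Rightarrow> br" where
  "br0 b \<nu> = ((\<lambda>c. Br c X0) ^^ \<nu>) b"

inductive_set G :: "br set" where
  "X0 \<in> G"
| "X1 \<in> G"
| "\<lbrakk>a \<in> G; b \<in> G; a \<noteq> X0\<rbrakk> \<Longrightarrow> Br a b \<in> G"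

text \<open>The decomposition \<open>b = b\<^sup>* 0\<^sup>\<nu>\<close>: \<open>germ b\<close> is \<open>b\<^sup>*\<close> and \<open>nu b\<close> is \<open>\<nu>\<^sub>b\<close>. It is meaningful for
  \<open>b \<in> G - {X0}\<close>, see \<open>germ_nu_decomp\<close> and \<open>germ_nu_unique\<close>; other values are never relevant.\<close>

fun germ :: "br \<Rightarrow> br" where
  "germ X0 = X0"
| "germ X1 = X1"
| "germ (Br a b) = (if b = X0 then germ a else Br a b)"

fun nu :: "br \<Rightarrow> nat" where
  "nu X0 = 0"
| "nu X1 = 0"
| "nu (Br a b) = (if b = X0 then Suc (nu a) else 0)"

lemma size_germ_le: "size (germ b) \<le> size b"
  by (induction b) auto

lemma G_Br_D: "Br a b \<in> G \<Longrightarrow> a \<in> G \<and> b \<in> G \<and> a \<noteq> X0"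
  by (auto elim: G.cases)

definition is_germ :: "br \<Rightarrow> bool" where
  "is_germ b \<longleftrightarrow> b = X1 \<or> (\<exists>b1 b2. b = Br b1 b2 \<and> b1 \<noteq> X0 \<and> b2 \<noteq> X0)"

lemma germ_nu_decomp:
  assumes "b \<in> G" "b \<noteq> X0"
  shows "b = br0 (germ b) (nu b) \<and> is_germ (germ b)"
  using assms by (induction b) (auto simp: br0_def is_germ_def)

lemma germ_nu_unique:
  assumes "is_germ c"
  shows "germ (br0 c \<nu>) = c \<and> nu (br0 c \<nu>) = \<nu>"
proof (induction \<nu>)
  case 0
  show ?case using assms by (auto simp: br0_def is_germ_def)
next
  case (Suc \<nu>)
  then show ?case by (simp add: br0_def)
qed

text \<open>The strict order on \<open>G\<close> (\<open>br_less\<close>) and its restriction to germs (\<open>germ_less\<close>). Two germs of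
  \<open>G\<close> with the same \<open>n1\<close> are either both \<open>X1\<close> or both brackets, so the comparison of factors only
  concerns the first equation of \<open>germ_less\<close>.\<close>

function (sequential) br_less :: "br \<Rightarrow> br \<Rightarrow> bool" and germ_less :: "br \<Rightarrow> br \<Rightarrow> bool" where
  "br_less a b \<longleftrightarrow>
     a \<noteq> X0 \<and> (b = X0 \<or> germ_less (germ a) (germ b) \<or> (germ a = germ b \<and> nu a < nu b))"
| "germ_less (Br a1 a2) (Br b1 b2) \<longleftrightarrow>
     n1 (Br a1 a2) < n1 (Br b1 b2) \<or>
     (n1 (Br a1 a2) = n1 (Br b1 b2) \<and> (br_less a1 b1 \<or> (a1 = b1 \<and> br_less a2 b2)))"
| "germ_less a b \<longleftrightarrow> n1 a < n1 b"
  by pat_completeness auto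
termination
  by (relation "Wellfounded.measure (\<lambda>s. case s of Inl (a, _) \<Rightarrow> 2 * size a + 1 | Inr (a, _) \<Rightarrow> 2 * size a)")
     (auto simp: size_germ_le less_Suc_eq_le)

text \<open>The Hall set \<open>\<B>\<^sup>\<star>\<close>.\<close>

inductive_set Bstar :: "br set" where
  "X0 \<in> Bstar"
| "X1 \<in> Bstar"
| "\<lbrakk>b1 \<in> Bstar; b2 \<in> Bstar; br_less b1 b2;
    b2 = X0 \<or> b2 = X1 \<or> (\<exists>c d. b2 = Br c d \<and> (br_less c b1 \<or> c = b1))\<rbrakk>
   \<Longrightarrow> Br b1 b2 \<in> Bstar"

lemma Bstar_Br_iff:
  "Br b1 b2 \<in> Bstar \<longleftrightarrow> b1 \<in> Bstar \<and> b2 \<in> Bstar \<and> br_less b1 b2 \<and>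
     (b2 = X0 \<or> b2 = X1 \<or> (\<exists>c d. b2 = Br c d \<and> (br_less c b1 \<or> c = b1)))"
  by (subst Bstar.simps) simp

lemma Bstar_subset_G: "Bstar \<subseteq> G"
proof
  fix b assume "b \<in> Bstar"
  then show "b \<in> G" by induction (auto intro: G.intros)
qed

lemma Bstar_unique:
  assumes "X0 \<in> B" "X1 \<in> B"
    and "\<And>b1 b2. Br b1 b2 \<in> B \<longleftrightarrow> b1 \<in> B \<and> b2 \<in> B \<and> br_less b1 b2 \<and>
      (b2 = X0 \<or> b2 = X1 \<or> (\<exists>c d. b2 = Br c d \<and> (br_less c b1 \<or> c = b1)))"
  shows "B = Bstar"
proof -
  have "b \<in> B \<longleftrightarrow> b \<in> Bstar" for b
    by (induction b) (use assms in \<open>simp_all add: Bstar_Br_iff Bstar.intros(1,2)\<close>)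
  then show ?thesis by blast
qed

text \<open>The families \<open>W\<close>, \<open>P\<close>, \<open>Q\<close> are only used with indices at least \<open>1\<close>.\<close>

definition M :: "nat \<Rightarrow> br" where "M \<nu> = br0 X1 \<nu>"
definition W :: "nat \<Rightarrow> br" where "W j = Br (M (j - 1)) (M j)"
definition P :: "nat \<Rightarrow> nat \<Rightarrow> br" where "P j k = Br (M (k - 1)) (W j)"
definition Q :: "nat \<Rightarrow> nat \<Rightarrow> nat \<Rightarrow> br" where "Q j k l = Br (M (l - 1)) (P j k)"

section \<open>Lie brackets of vector fields\<close>

definition lie_bracket ::
  "('a::real_normed_vector \<Rightarrow> 'a) \<Rightarrow> ('a \<Rightarrow> 'a) \<Rightarrow> 'a \<Rightarrow> 'a" where
  "lie_bracket f g x = frechet_derivative g (at x) (f x) - frechet_derivative f (at x) (g x)"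

primrec eval_br ::
  "('a::real_normed_vector \<Rightarrow> 'a) \<Rightarrow> ('a \<Rightarrow> 'a) \<Rightarrow> br \<Rightarrow> 'a \<Rightarrow> 'a" where
  "eval_br f0 f1 X0 = f0"
| "eval_br f0 f1 X1 = f1"
| "eval_br f0 f1 (Br a b) = lie_bracket (eval_br f0 f1 a) (eval_br f0 f1 b)"

section \<open>Spaces of controls\<close>

text \<open>For measurable \<open>u\<close> this is the norm of \<open>L\<^sup>\<infinity>(0,T)\<close>, with value \<open>\<infinity>\<close> if \<open>u\<close> is not essentially
  bounded. Below it is only applied to functions that are measurable on \<open>(0,T)\<close>.\<close>

definition Linf_norm :: "real \<Rightarrow> (real \<Rightarrow> real) \<Rightarrow> ereal" where
  "Linf_norm T u = esssup (lebesgue_on {0<..<T}) (\<lambda>t. ereal \<bar>u t\<bar>)"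

definition L1_loc :: "real \<Rightarrow> (real \<Rightarrow> real) set" where
  "L1_loc T = {u. \<forall>a b. 0 < a \<and> b < T \<longrightarrow> u absolutely_integrable_on {a..b}}"

text \<open>\<open>C\<^sub>c\<^sup>\<infinity>(0,T)\<close>, with functions extended by zero to the real line.\<close>

definition test_functions :: "real \<Rightarrow> (real \<Rightarrow> real) set" where
  "test_functions T =
     {\<phi>. (\<forall>k x. (deriv ^^ k) \<phi> field_differentiable (at x)) \<and>
         (\<exists>a b. 0 < a \<and> b < T \<and> (\<forall>x. x \<notin> {a..b} \<longrightarrow> \<phi> x = 0))}"

definition weak_deriv :: "real \<Rightarrow> nat \<Rightarrow> (real \<Rightarrow> real) \<Rightarrow> (real \<Rightarrow> real) \<Rightarrow> bool" where
  "weak_deriv T k u v \<longleftrightarrow> u \<in> L1_loc T \<and> v \<in> L1_loc T \<and>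
     (\<forall>\<phi>\<in>test_functions T.
        integral {0<..<T} (\<lambda>t. u t * (deriv ^^ k) \<phi> t) =
        (-1) ^ k * integral {0<..<T} (\<lambda>t. v t * \<phi> t))"

definition Winf :: "nat \<Rightarrow> real \<Rightarrow> (real \<Rightarrow> real) set" where
  "Winf m T = {u. \<forall>k\<le>m. \<exists>v. weak_deriv T k u v \<and> Linf_norm T v < \<infinity>}"

text \<open>\<open>\<Sum>\<^sub>k\<^sub>\<le>\<^sub>m \<parallel>u\<^sup>(\<^sup>k\<^sup>)\<parallel>\<close>. The weak derivative \<open>u\<^sup>(\<^sup>k\<^sup>)\<close> is unique up to a null set and \<open>Linf_norm\<close> does not
  see null sets, so each infimum is over a single value (or over the empty set, giving \<open>\<infinity>\<close>).\<close>

definition Winf_norm :: "nat \<Rightarrow> real \<Rightarrow> (real \<Rightarrow> real) \<Rightarrow> ereal" where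
  "Winf_norm m T u = (\<Sum>k\<le>m. INF v\<in>{v. weak_deriv T k u v}. Linf_norm T v)"

text \<open>Boundary values of \<open>u\<^sup>(\<^sup>k\<^sup>)\<close>, \<open>k < m\<close>, are those of its representative \<open>w\<close> that is continuous on
  \<open>[0,T]\<close>.\<close>

definition Winf0 :: "nat \<Rightarrow> real \<Rightarrow> (real \<Rightarrow> real) set" where
  "Winf0 m T = {u \<in> Winf m T.
     \<forall>k<m. \<exists>w. weak_deriv T k u w \<and> continuous_on {0..T} w \<and> w 0 = 0 \<and> w T = 0}"

definition L1_space :: "real \<Rightarrow> (real \<Rightarrow> real) set" where
  "L1_space T = {u. u absolutely_integrable_on {0<..<T}}"

text \<open>The norm of \<open>W\<^sup>-\<^sup>1\<^sup>,\<^sup>\<infinity>(0,T)\<close>: the sup norm of the primitive \<open>u\<^sub>1\<close> of \<open>u\<close>.\<close>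

definition Wm1_norm :: "real \<Rightarrow> (real \<Rightarrow> real) \<Rightarrow> ereal" where
  "Wm1_norm T u = Linf_norm T (\<lambda>t. integral {0..t} u)"

section \<open>Small-time local controllability\<close>

text \<open>\<open>x\<close> is the (Caratheodory) solution on \<open>[0,T]\<close> of \<open>x' = f0(x) + u f1(x)\<close>, \<open>x(0) = 0\<close>.
  Since the integrand is required to be Lebesgue integrable, \<open>integral\<close> is a Lebesgue integral
  and \<open>x\<close> is absolutely continuous.\<close>

definition is_solution ::
  "('a::euclidean_space \<Rightarrow> 'a) \<Rightarrow> ('a \<Rightarrow> 'a) \<Rightarrow> real \<Rightarrow> (real \<Rightarrow> real) \<Rightarrow> (real \<Rightarrow> 'a) \<Rightarrow> bool" where
  "is_solution f0 f1 T u x \<longleftrightarrow>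
     continuous_on {0..T} x \<and>
     (\<lambda>s. f0 (x s) + u s *\<^sub>R f1 (x s)) absolutely_integrable_on {0..T} \<and>
     (\<forall>t\<in>{0..T}. x t = integral {0..t} (\<lambda>s. f0 (x s) + u s *\<^sub>R f1 (x s)))"

definition STLC ::
  "(real \<Rightarrow> (real \<Rightarrow> real) set) \<Rightarrow> (real \<Rightarrow> (real \<Rightarrow> real) \<Rightarrow> ereal) \<Rightarrow>
   ('a::euclidean_space \<Rightarrow> 'a) \<Rightarrow> ('a \<Rightarrow> 'a) \<Rightarrow> bool" where
  "STLC U N f0 f1 \<longleftrightarrow>
     (\<forall>T>0. \<forall>\<rho>>0. \<exists>\<delta>>0. \<forall>xs\<in>ball 0 \<delta>. \<exists>u\<in>U T.
        N T u \<le> ereal \<rho> \<and> (\<exists>x. is_solution f0 f1 T u x \<and> x T = xs))"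

definition Wm1_STLC :: "('a::euclidean_space \<Rightarrow> 'a) \<Rightarrow> ('a \<Rightarrow> 'a) \<Rightarrow> bool" where
  "Wm1_STLC = STLC L1_space Wm1_norm"

definition Winf0_STLC :: "nat \<Rightarrow> ('a::euclidean_space \<Rightarrow> 'a) \<Rightarrow> ('a \<Rightarrow> 'a) \<Rightarrow> bool" where
  "Winf0_STLC m = STLC (Winf0 m) (Winf_norm m)"

definition smoothly_STLC :: "('a::euclidean_space \<Rightarrow> 'a) \<Rightarrow> ('a \<Rightarrow> 'a) \<Rightarrow> bool" where
  "smoothly_STLC f0 f1 \<longleftrightarrow> (\<forall>m. Winf0_STLC m f0 f1)"

section \<open>The system\<close>

definition sys_f0 :: "real \<Rightarrow> real^4 \<Rightarrow> real^4" where
  "sys_f0 lam x = vector [0, x $ 1, x $ 2, (x $ 1)\<^sup>2 * (x $ 3)\<^sup>2 - lam * (x $ 2) ^ 4]"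

definition sys_f1 :: "real^4 \<Rightarrow> real^4" where
  "sys_f1 x = axis 1 1"

lemma sys_f0_nth:
  "sys_f0 lam x $ 1 = 0"
  "sys_f0 lam x $ 2 = x $ 1"
  "sys_f0 lam x $ 3 = x $ 2"
  "sys_f0 lam x $ 4 = (x $ 1)\<^sup>2 * (x $ 3)\<^sup>2 - lam * (x $ 2) ^ 4"
  unfolding sys_f0_def vector_def by simp_all

end

theory Submission
  imports Defs
begin

text \<open>
  The critical value is \<open>\<lambda>\<^sup>* = 1/9\<close>. With \<open>f = x\<^sub>3\<close>, so that \<open>f' = x\<^sub>2\<close> and \<open>f'' = x\<^sub>1\<close>, the last
  component of the final state is \<open>J(f) = \<integral> f''\<^sup>2 f\<^sup>2 - \<lambda> f'\<^sup>4\<close>. If \<open>f\<close> vanishes at both ends of the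
  interval, then \<open>0 = \<integral> (f f'\<^sup>3)' = \<integral> f'\<^sup>4 + 3 f f'\<^sup>2 f''\<close>, and integrating \<open>(3 f f'' + f'\<^sup>2)\<^sup>2 \<ge> 0\<close>
  gives \<open>J(f) \<ge> 0\<close> for \<open>\<lambda> \<le> 1/9\<close>, so that no state \<open>- c e\<^sub>4\<close> with \<open>c > 0\<close> is reachable.

  For \<open>\<lambda> > 1/9\<close> there are test functions with \<open>J(f) < 0\<close> and with \<open>J(f) > 0\<close>. Scaled copies of them,
  used on the first half of the time interval, move the state to any \<open>z e\<^sub>4\<close>. On the second half the
  first three components are steered linearly to their targets; this adds to \<open>x\<^sub>4\<close> an amount that does
  not depend on the first half, and that is compensated by the choice of \<open>z\<close>.

  For the brackets: \<open>f\<^sub>b\<close> is a constant plus \<open>g e\<^sub>4\<close> with \<open>g\<close> homogeneous of degree \<open>4 - n\<^sub>1(b)\<close> in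
  \<open>x\<^sub>1, x\<^sub>2, x\<^sub>3\<close>, and the constant vanishes if \<open>n\<^sub>1(b) \<ge> 2\<close>. So only \<open>n\<^sub>1(b) = 1\<close> and \<open>n\<^sub>1(b) = 4\<close> matter,
  and in the latter case the Hall condition leaves only the \<open>Q\<^bsub>j,k,l\<^esub>\<close>.
\<close>

section \<open>Brackets of the system\<close>

text \<open>Homogeneous polynomials in the first three coordinates. The degree is an integer so that
  each differentiation lowers it by one without truncation; in negative degree only the zero
  function is left.\<close>

inductive_set homog :: "int \<Rightarrow> (real^4 \<Rightarrow> real) set" for d where
  zero: "(\<lambda>x. 0) \<in> homog d"
| monom: "int (i + j + k) = d \<Longrightarrow> (\<lambda>x. c * (x $ 1) ^ i * (x $ 2) ^ j * (x $ 3) ^ k) \<in> homog d"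
| add: "f \<in> homog d \<Longrightarrow> g \<in> homog d \<Longrightarrow> (\<lambda>x. f x + g x) \<in> homog d"

lemma homog_neg: "f \<in> homog d \<Longrightarrow> d < 0 \<Longrightarrow> f = (\<lambda>x. 0)"
  by (induction rule: homog.induct) auto

lemma homog_at_0: "f \<in> homog d \<Longrightarrow> d > 0 \<Longrightarrow> f 0 = 0"
  by (induction rule: homog.induct) (auto simp: power_0_left)

lemma homog_cmult: "f \<in> homog d \<Longrightarrow> (\<lambda>x. c * f x) \<in> homog d"
proof (induction rule: homog.induct)
  case zero then show ?case by (simp add: homog.zero)
next
  case (monom i j k c')
  from homog.monom[OF this, of "c * c'"] show ?case by (simp add: mult.assoc)
next
  case (add f g)
  from homog.add[OF this(3,4)] show ?case by (simp add: distrib_left)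
qed

lemma homog_nth_mult:
  assumes "f \<in> homog d" "m \<in> {1, 2, 3}"
  shows "(\<lambda>x. x $ m * f x) \<in> homog (d + 1)"
  using assms(1)
proof (induction rule: homog.induct)
  case zero then show ?case by (simp add: homog.zero)
next
  case (monom i j k c)
  show ?case
    using assms(2) monom homog.monom[of "Suc i" j k "d + 1" c] homog.monom[of i "Suc j" k "d + 1" c]
      homog.monom[of i j "Suc k" "d + 1" c]
    by (auto simp: mult_ac)
next
  case (add f g)
  from homog.add[OF this(3,4)] show ?case by (simp add: distrib_left)
qed

lemma homog_monom':
  "int (i + j + k) = d \<or> c = 0 \<Longrightarrow> (\<lambda>x. c * (x $ 1) ^ i * (x $ 2) ^ j * (x $ 3) ^ k) \<in> homog d"
  using homog.intros by auto

text \<open>The functions do not depend on \<open>x $ 4\<close>, so the differential has no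
  \<open>h $ 4\<close> term. This is what makes vertical fields commute below.\<close>

lemma homog_deriv:
  assumes "f \<in> homog d"
  shows "\<exists>f1\<in>homog (d - 1). \<exists>f2\<in>homog (d - 1). \<exists>f3\<in>homog (d - 1). \<forall>x.
    (f has_derivative (\<lambda>h. f1 x * h $ 1 + f2 x * h $ 2 + f3 x * h $ 3)) (at x)"
  using assms
proof (induction rule: homog.induct)
  case zero
  show ?case by (intro bexI[of _ "\<lambda>x. 0"]) (auto intro: homog.zero)
next
  case (monom i j k c)
  define f1 f2 f3 where
    "f1 x = (c * real i) * (x $ 1) ^ (i - 1) * (x $ 2) ^ j * (x $ 3) ^ k" and
    "f2 x = (c * real j) * (x $ 1) ^ i * (x $ 2) ^ (j - 1) * (x $ 3) ^ k" and
    "f3 x = (c * real k) * (x $ 1) ^ i * (x $ 2) ^ j * (x $ 3) ^ (k - 1)" for x :: "real^4"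
  have "f1 \<in> homog (d - 1)" "f2 \<in> homog (d - 1)" "f3 \<in> homog (d - 1)"
    unfolding f1_def[abs_def] f2_def[abs_def] f3_def[abs_def]
    using monom by (intro homog_monom'; cases i; cases j; cases k; auto)+
  moreover have "((\<lambda>x. c * (x $ 1) ^ i * (x $ 2) ^ j * (x $ 3) ^ k) has_derivative
      (\<lambda>h. f1 x * h $ 1 + f2 x * h $ 2 + f3 x * h $ 3)) (at x)" for x
    unfolding f1_def f2_def f3_def
    by (auto intro!: derivative_eq_intros bounded_linear.has_derivative[OF bounded_linear_vec_nth]
        simp: algebra_simps)
  ultimately show ?case by blast
next
  case (add f g)
  then obtain f1 f2 f3 g1 g2 g3 where
    "f1 \<in> homog (d - 1)" "f2 \<in> homog (d - 1)" "f3 \<in> homog (d - 1)"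
    "g1 \<in> homog (d - 1)" "g2 \<in> homog (d - 1)" "g3 \<in> homog (d - 1)" and *:
    "\<And>x. (f has_derivative (\<lambda>h. f1 x * h $ 1 + f2 x * h $ 2 + f3 x * h $ 3)) (at x)"
    "\<And>x. (g has_derivative (\<lambda>h. g1 x * h $ 1 + g2 x * h $ 2 + g3 x * h $ 3)) (at x)"
    by blast
  then show ?case
    by (intro bexI[of _ "\<lambda>x. f1 x + g1 x"] bexI[of _ "\<lambda>x. f2 x + g2 x"] bexI[of _ "\<lambda>x. f3 x + g3 x"])
       (auto intro!: homog.add has_derivative_eq_rhs[OF has_derivative_add[OF *]] simp: algebra_simps)
qed

text \<open>A constant field plus a field along the fourth axis. As long as \<open>g\<close> depends
  on the first three coordinates only, this class is stable under brackets, including those with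
  \<open>sys_f0\<close>.\<close>

definition vert :: "real^4 \<Rightarrow> (real^4 \<Rightarrow> real) \<Rightarrow> real^4 \<Rightarrow> real^4" where
  "vert c g x = c + g x *\<^sub>R axis 4 1"

lemma lie_bracket_eq:
  assumes "(f has_derivative f') (at x)" "(g has_derivative g') (at x)"
  shows "lie_bracket f g x = g' (f x) - f' (g x)"
  unfolding lie_bracket_def
  using frechet_derivative_at[OF assms(1)] frechet_derivative_at[OF assms(2)] by simp

lemma vert_has_derivative:
  "(g has_derivative g') (at x) \<Longrightarrow> (vert c g has_derivative (\<lambda>h. g' h *\<^sub>R axis 4 1)) (at x)"
  unfolding vert_def[abs_def] by (auto intro!: derivative_eq_intros)

lemma vert_nth:
  "vert c g x $ 1 = c $ 1" "vert c g x $ 2 = c $ 2" "vert c g x $ 3 = c $ 3"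
  "vert c g x $ 4 = c $ 4 + g x"
  by (simp_all add: vert_def axis_def)

lemma vec4_eq_iff: "(x :: real^4) = y \<longleftrightarrow> x $ 1 = y $ 1 \<and> x $ 2 = y $ 2 \<and> x $ 3 = y $ 3 \<and> x $ 4 = y $ 4"
  by (simp add: vec_eq_iff forall_4)

text \<open>The linear part of \<open>sys_f0\<close> at the origin, a nilpotent map e_1 to e_2 to
  e_3 to 0.\<close>

definition shift :: "real^4 \<Rightarrow> real^4" where
  "shift c = vector [0, c $ 1, c $ 2, 0]"

lemma shift_nth: "shift c $ 1 = 0" "shift c $ 2 = c $ 1" "shift c $ 3 = c $ 2" "shift c $ 4 = 0"
  unfolding shift_def vector_def by simp_all

lemma shift_0: "shift 0 = 0"
  by (simp add: vec4_eq_iff shift_nth)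

lemma sys_f0_eq:
  "sys_f0 lam = (\<lambda>x. (x $ 1) *\<^sub>R axis 2 1 + (x $ 2) *\<^sub>R axis 3 1 +
     ((x $ 1)\<^sup>2 * (x $ 3)\<^sup>2 - lam * (x $ 2) ^ 4) *\<^sub>R axis 4 1)"
  by (rule ext) (simp add: vec4_eq_iff sys_f0_nth axis_def)

lemma sys_f0_has_derivative:
  "(sys_f0 lam has_derivative (\<lambda>h. shift h +
     (2 * x $ 1 * (x $ 3)\<^sup>2 * h $ 1 - 4 * lam * (x $ 2) ^ 3 * h $ 2 + 2 * (x $ 1)\<^sup>2 * x $ 3 * h $ 3)
     *\<^sub>R axis 4 1)) (at x)"
  unfolding sys_f0_eq
  by (rule derivative_eq_intros bounded_linear.has_derivative[OF bounded_linear_vec_nth] refl)+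
     (auto simp: fun_eq_iff vec4_eq_iff axis_def shift_nth algebra_simps power3_eq_cube power2_eq_square)

text \<open>Each constant part differentiates the vertical part of the other field; the two vertical
  parts do not interact, since neither sees \<open>x $ 4\<close>.\<close>

lemma lie_bracket_vert_vert:
  assumes f: "\<And>x. (f has_derivative (\<lambda>h. f1 x * h $ 1 + f2 x * h $ 2 + f3 x * h $ 3)) (at x)"
    and g: "\<And>x. (g has_derivative (\<lambda>h. g1 x * h $ 1 + g2 x * h $ 2 + g3 x * h $ 3)) (at x)"
  shows "lie_bracket (vert c f) (vert e g) = vert 0 (\<lambda>x.
    (g1 x * c $ 1 + g2 x * c $ 2 + g3 x * c $ 3) - (f1 x * e $ 1 + f2 x * e $ 2 + f3 x * e $ 3))"
  by (rule ext, subst lie_bracket_eq[OF vert_has_derivative[OF f] vert_has_derivative[OF g]])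
     (simp add: vec4_eq_iff axis_def vert_nth)

text \<open>The differential of \<open>sys_f0\<close> acts only on the constant \<open>c\<close>, as
  it ignores the fourth coordinate, while \<open>f\<close> is differentiated along the drift
  \<open>(0, x1, x2)\<close>.\<close>

lemma lie_bracket_vert_f0:
  assumes f: "\<And>x. (f has_derivative (\<lambda>h. f1 x * h $ 1 + f2 x * h $ 2 + f3 x * h $ 3)) (at x)"
  shows "lie_bracket (vert c f) (sys_f0 lam) = vert (shift c) (\<lambda>x.
    (2 * x $ 1 * (x $ 3)\<^sup>2 * c $ 1 - 4 * lam * (x $ 2) ^ 3 * c $ 2 + 2 * (x $ 1)\<^sup>2 * x $ 3 * c $ 3)
    - (x $ 1 * f2 x + x $ 2 * f3 x))"
  by (rule ext, subst lie_bracket_eq[OF vert_has_derivative[OF f] sys_f0_has_derivative])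
     (simp add: vec4_eq_iff axis_def vert_nth shift_nth sys_f0_nth algebra_simps)

section \<open>Formal brackets sorted by the number of occurrences of \<open>X1\<close>\<close>

lemma n1_pos: "b \<in> G \<Longrightarrow> b \<noteq> X0 \<Longrightarrow> n1 b \<ge> 1"
  by (induction rule: G.induct) auto

text \<open>Both factors would contain \<open>X1\<close> unless the right one is \<open>X0\<close>,
  so the bracket arises from \<open>X1\<close> by appending \<open>X0\<close> only.\<close>

lemma n1_1_imp_M: "b \<in> G \<Longrightarrow> n1 b = 1 \<Longrightarrow> \<exists>\<nu>. b = M \<nu>"
proof (induction rule: G.induct)
  case 2
  show ?case by (rule exI[of _ 0]) (simp add: M_def br0_def)
next
  case (3 a b)
  have "n1 a \<ge> 1" using n1_pos 3 by auto
  then have "b = X0" using n1_pos[of b] 3 by force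
  then obtain \<nu> where "a = M \<nu>" using 3 by auto
  then have "Br a b = M (Suc \<nu>)" using \<open>b = X0\<close> by (simp add: M_def br0_def)
  then show ?case by blast
qed auto

lemma M_0: "M 0 = X1" and M_Suc: "M (Suc n) = Br (M n) X0"
  by (simp_all add: M_def br0_def)

lemma n1_M: "n1 (M n) = 1" and nu_M: "nu (M n) = n" and germ_M: "germ (M n) = X1"
  and M_neq_X0: "M n \<noteq> X0" and M_inject: "M i = M j \<longleftrightarrow> i = j"
proof -
  show 1: "n1 (M n) = 1" "nu (M n) = n" "germ (M n) = X1" for n by (induction n) (auto simp: M_0 M_Suc)
  then show "M n \<noteq> X0" by (metis n1.simps(1) zero_neq_one)
  show "M i = M j \<longleftrightarrow> i = j" using 1 by metis
qed

lemma br_less_M: "br_less (M i) (M j) \<longleftrightarrow> i < j"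
  by (simp add: germ_M nu_M M_neq_X0)

lemma n1_germ: "n1 (germ b) = n1 b"
  by (induction b) auto

text \<open>Germs are compared by \<open>n1\<close> first, and passing to the germ only removes
  copies of \<open>X0\<close>. The exception for \<open>X0\<close> reflects that it is maximal
  although \<open>n1 X0 = 0\<close>.\<close>

lemma br_less_n1:
  "br_less a b \<Longrightarrow> b \<noteq> X0 \<Longrightarrow> n1 a \<le> n1 b"
  "germ_less a b \<Longrightarrow> n1 a \<le> n1 b"
proof (induction a b and a b rule: br_less_germ_less.induct)
  case (1 a b)
  then show ?case using n1_germ[of a] n1_germ[of b] by auto
qed auto

declare br_less.simps [simp del] germ_less.simps [simp del]

text \<open>The value at 0 of the bracket \<open>M i\<close>: the orbit of e_1 under
  \<open>shift\<close>, which dies after three steps.\<close>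

definition M_const :: "nat \<Rightarrow> real^4" where
  "M_const i = (if i = 0 then axis 1 1 else if i = 1 then axis 2 1 else if i = 2 then axis 3 1 else 0)"

lemma M_const_Suc: "M_const (Suc i) = shift (M_const i)"
  by (auto simp: M_const_def vec4_eq_iff shift_nth axis_def)


text \<open>Degree count. The quartic drift term yields cubics when contracted with a constant
  field, a further bracket with \<open>X0\<close> preserves the degree, and a bracket with a field
  of nonzero constant part, which requires \<open>n1 = 1\<close>, lowers it by one.\<close>

lemma eval_form:
  assumes "b \<in> G" "b \<noteq> X0"
  shows "\<exists>f\<in>homog (4 - int (n1 b)).
    eval_br (sys_f0 lam) sys_f1 b = vert (if n1 b \<ge> 2 then 0 else M_const (nu b)) f"
  using assms
proof (induction rule: G.induct)
  case 2
  show ?case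
    by (rule bexI[of _ "\<lambda>x. 0"]) (auto simp: vert_def sys_f1_def homog.zero M_const_def)
next
  case (3 a b)
  define c where "c = (if n1 a \<ge> 2 then 0 else M_const (nu a))"
  obtain f where f: "f \<in> homog (4 - int (n1 a))"
    "eval_br (sys_f0 lam) sys_f1 a = vert c f" using 3 unfolding c_def by blast
  obtain f1 f2 f3 where df: "f1 \<in> homog (4 - int (n1 a) - 1)" "f2 \<in> homog (4 - int (n1 a) - 1)"
    "f3 \<in> homog (4 - int (n1 a) - 1)"
    "\<And>x. (f has_derivative (\<lambda>h. f1 x * h $ 1 + f2 x * h $ 2 + f3 x * h $ 3)) (at x)"
    using homog_deriv[OF f(1)] by blast
  have na: "n1 a \<ge> 1" using 3 n1_pos by blast
  show ?case
  proof (cases "b = X0")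
    case True
    define g where "g x = ((2 * c $ 1) * (x $ 1) ^ 1 * (x $ 2) ^ 0 * (x $ 3) ^ 2
       + ((-4 * lam * c $ 2) * (x $ 1) ^ 0 * (x $ 2) ^ 3 * (x $ 3) ^ 0
        + (2 * c $ 3) * (x $ 1) ^ 2 * (x $ 2) ^ 0 * (x $ 3) ^ 1))
       + ((-1) * (x $ 1 * f2 x) + (-1) * (x $ 2 * f3 x))" for x :: "real^4"
    have "(\<lambda>x. (-1) * (x $ 1 * f2 x)) \<in> homog (4 - int (n1 a))"
      "(\<lambda>x. (-1) * (x $ 2 * f3 x)) \<in> homog (4 - int (n1 a))"
      using homog_cmult[OF homog_nth_mult[OF df(2), of 1], of "-1"]
        homog_cmult[OF homog_nth_mult[OF df(3), of 2], of "-1"] by simp_all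
    moreover have "c = 0 \<or> n1 a = 1" using na by (auto simp: c_def)
    ultimately have "g \<in> homog (4 - int (n1 a))"
      unfolding g_def[abs_def] by (intro homog.add homog_monom') auto
    moreover have "eval_br (sys_f0 lam) sys_f1 (Br a b) = vert (shift c) g"
      by (simp add: True f lie_bracket_vert_f0[OF df(4)] g_def[abs_def] algebra_simps
          power2_eq_square)
    moreover have "shift c = (if n1 (Br a b) \<ge> 2 then 0 else M_const (nu (Br a b)))"
      using True by (simp add: c_def M_const_Suc shift_0)
    ultimately show ?thesis using True by (intro bexI[of _ g]) auto
  next
    case False
    then have nb: "n1 b \<ge> 1" using 3 n1_pos by blast
    define e where "e = (if n1 b \<ge> 2 then 0 else M_const (nu b))"
    obtain g where g: "g \<in> homog (4 - int (n1 b))"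
      "eval_br (sys_f0 lam) sys_f1 b = vert e g" using 3 False unfolding e_def by blast
    obtain g1 g2 g3 where dg: "g1 \<in> homog (4 - int (n1 b) - 1)" "g2 \<in> homog (4 - int (n1 b) - 1)"
      "g3 \<in> homog (4 - int (n1 b) - 1)"
      "\<And>x. (g has_derivative (\<lambda>h. g1 x * h $ 1 + g2 x * h $ 2 + g3 x * h $ 3)) (at x)"
      using homog_deriv[OF g(1)] by blast
    define k where "k x = (c $ 1 * g1 x + (c $ 2 * g2 x + c $ 3 * g3 x))
      + ((- e $ 1) * f1 x + ((- e $ 2) * f2 x + (- e $ 3) * f3 x))" for x
    \<comment> \<open>A derivative of \<open>g\<close> has the right degree only for
      \<open>n1 a = 1\<close>; otherwise its coefficient, a component of \<open>c\<close>, is zero.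
      The same holds with the roles exchanged.\<close>
    have *: "(\<lambda>x. r * h x) \<in> homog (4 - int (n1 (Br a b)))"
      if "h \<in> homog d" "r = 0 \<or> d = 4 - int (n1 (Br a b))" for r h d
      using that homog_cmult by (auto simp: homog.zero)
    have "c = 0 \<or> n1 a = 1" "e = 0 \<or> n1 b = 1" using na nb by (auto simp: c_def e_def)
    then have "k \<in> homog (4 - int (n1 (Br a b)))"
      unfolding k_def[abs_def]
      by (intro homog.add *[OF dg(1)] *[OF dg(2)] *[OF dg(3)] *[OF df(1)] *[OF df(2)] *[OF df(3)]) auto
    moreover have "eval_br (sys_f0 lam) sys_f1 (Br a b) = vert 0 k"
      by (simp add: f g lie_bracket_vert_vert[OF df(4) dg(4)] k_def[abs_def] algebra_simps)
    moreover have "n1 (Br a b) \<ge> 2" using na nb by simp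
    ultimately show ?thesis by auto
  qed
qed auto



section \<open>Explicit values of brackets\<close>

lemma M_in_Bstar: "M n \<in> Bstar"
  by (induction n) (auto simp: M_0 M_Suc br_less.simps M_neq_X0 intro: Bstar.intros)

lemma eval_M: "\<exists>f\<in>homog 3. eval_br (sys_f0 lam) sys_f1 (M i) = vert (M_const i) f"
  using eval_form[of "M i" lam] M_in_Bstar Bstar_subset_G by (auto simp: M_neq_X0 n1_M nu_M)

lemma eval_M0: "eval_br (sys_f0 lam) sys_f1 (M 0) = vert (M_const 0) (\<lambda>x. 0)"
  by (auto simp: M_0 vert_def sys_f1_def M_const_def)

lemma eval_M1: "eval_br (sys_f0 lam) sys_f1 (M 1) = vert (M_const 1) (\<lambda>x. 2 * x $ 1 * (x $ 3)\<^sup>2)"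
  using lie_bracket_vert_f0[of "\<lambda>x. 0" "\<lambda>x. 0" "\<lambda>x. 0" "\<lambda>x. 0" "M_const 0" lam] eval_M0
  by (simp add: M_Suc M_const_Suc) (simp add: M_const_def axis_def)

lemma eval_M2: "eval_br (sys_f0 lam) sys_f1 (M 2) =
  vert (M_const 2) (\<lambda>x. - 4 * lam * (x $ 2) ^ 3 - 4 * x $ 1 * x $ 2 * x $ 3)"
proof -
  have "((\<lambda>x. 2 * x $ 1 * (x $ 3)\<^sup>2) has_derivative
    (\<lambda>h. (2 * (x $ 3)\<^sup>2) * h $ 1 + 0 * h $ 2 + (4 * x $ 1 * x $ 3) * h $ 3)) (at x)" for x :: "real^4"
    by (auto intro!: derivative_eq_intros bounded_linear.has_derivative[OF bounded_linear_vec_nth]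
        simp: algebra_simps)
  note bracket = lie_bracket_vert_f0[OF this, of "M_const 1" lam]
  have "eval_br (sys_f0 lam) sys_f1 (M 2) =
      lie_bracket (vert (M_const 1) (\<lambda>x. 2 * x $ 1 * (x $ 3)\<^sup>2)) (sys_f0 lam)"
    using M_Suc[of 1] by (simp only: Suc_1 eval_br.simps eval_M1)
  also have "\<dots> = vert (M_const 2) (\<lambda>x. - 4 * lam * (x $ 2) ^ 3 - 4 * x $ 1 * x $ 2 * x $ 3)"
    unfolding bracket using M_const_Suc[of 1] by (simp add: numeral_2_eq_2) (simp add: M_const_def axis_def algebra_simps)
  finally show ?thesis .
qed

text \<open>The constant part is already 0, but the vertical part matters once more: its
  \<open>x $ 3\<close>-derivative gives the bracket of \<open>M 2\<close> and
  \<open>M 3\<close>.\<close>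

lemma eval_M3: "eval_br (sys_f0 lam) sys_f1 (M 3) =
  vert (M_const 3) (\<lambda>x. 6 * (x $ 1)\<^sup>2 * x $ 3 + (12 * lam + 4) * x $ 1 * (x $ 2)\<^sup>2)"
proof -
  have "((\<lambda>x. - 4 * lam * (x $ 2) ^ 3 - 4 * x $ 1 * x $ 2 * x $ 3) has_derivative
    (\<lambda>h. (- 4 * x $ 2 * x $ 3) * h $ 1 + (- 12 * lam * (x $ 2)\<^sup>2 - 4 * x $ 1 * x $ 3) * h $ 2
       + (- 4 * x $ 1 * x $ 2) * h $ 3)) (at x)" for x :: "real^4"
    by (auto intro!: derivative_eq_intros bounded_linear.has_derivative[OF bounded_linear_vec_nth]
        simp: algebra_simps)
  note bracket = lie_bracket_vert_f0[OF this, of "M_const 2" lam]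
  have "M 3 = Br (M 2) X0" using M_Suc[of 2] by simp
  then have "eval_br (sys_f0 lam) sys_f1 (M 3) = lie_bracket (vert (M_const 2)
      (\<lambda>x. - 4 * lam * (x $ 2) ^ 3 - 4 * x $ 1 * x $ 2 * x $ 3)) (sys_f0 lam)"
    by (simp only: eval_br.simps eval_M2)
  also have "\<dots> = vert (M_const 3) (\<lambda>x. 6 * (x $ 1)\<^sup>2 * x $ 3 + (12 * lam + 4) * x $ 1 * (x $ 2)\<^sup>2)"
    unfolding bracket using M_const_Suc[of 2] shift_0
    by (simp add: M_const_def axis_def algebra_simps power2_eq_square)
  finally show ?thesis .
qed

text \<open>By the degree count, brackets with two \<open>X1\<close> have quadratic vertical parts;
  these four monomials cover those computed below.\<close>

definition quad :: "real \<Rightarrow> real \<Rightarrow> real \<Rightarrow> real \<Rightarrow> real^4 \<Rightarrow> real" where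
  "quad a b c d x = a * (x $ 2)\<^sup>2 + b * (x $ 1 * x $ 3) + c * (x $ 3)\<^sup>2 + d * (x $ 1)\<^sup>2"

lemma eval_W:
  "eval_br (sys_f0 lam) sys_f1 (Br (M 0) (M 1)) = vert 0 (quad 0 0 2 0)"
  "eval_br (sys_f0 lam) sys_f1 (Br (M 1) (M 2)) = vert 0 (quad (- 12 * lam) (- 8) 0 0)"
  "eval_br (sys_f0 lam) sys_f1 (Br (M 2) (M 3)) = vert 0 (quad 0 0 0 6)"
proof -
  note deriv = derivative_eq_intros bounded_linear.has_derivative[OF bounded_linear_vec_nth]
  have 0: "((\<lambda>x. 0) has_derivative (\<lambda>h. 0 * h $ 1 + 0 * h $ 2 + 0 * h $ 3)) (at x)" for x :: "real^4"
    by (auto intro!: deriv)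
  have 1: "((\<lambda>x. 2 * x $ 1 * (x $ 3)\<^sup>2) has_derivative
    (\<lambda>h. (2 * (x $ 3)\<^sup>2) * h $ 1 + 0 * h $ 2 + (4 * x $ 1 * x $ 3) * h $ 3)) (at x)" for x :: "real^4"
    by (auto intro!: deriv simp: algebra_simps)
  have 2: "((\<lambda>x. - 4 * lam * (x $ 2) ^ 3 - 4 * x $ 1 * x $ 2 * x $ 3) has_derivative
    (\<lambda>h. (- 4 * x $ 2 * x $ 3) * h $ 1 + (- 12 * lam * (x $ 2)\<^sup>2 - 4 * x $ 1 * x $ 3) * h $ 2
       + (- 4 * x $ 1 * x $ 2) * h $ 3)) (at x)" for x :: "real^4"
    by (auto intro!: deriv simp: algebra_simps)
  have 3: "((\<lambda>x. 6 * (x $ 1)\<^sup>2 * x $ 3 + (12 * lam + 4) * x $ 1 * (x $ 2)\<^sup>2) has_derivative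
    (\<lambda>h. (12 * x $ 1 * x $ 3 + (12 * lam + 4) * (x $ 2)\<^sup>2) * h $ 1
       + (2 * (12 * lam + 4) * x $ 1 * x $ 2) * h $ 2 + (6 * (x $ 1)\<^sup>2) * h $ 3)) (at x)" for x :: "real^4"
    by (auto intro!: deriv simp: algebra_simps)
  show "eval_br (sys_f0 lam) sys_f1 (Br (M 0) (M 1)) = vert 0 (quad 0 0 2 0)"
    unfolding eval_br.simps eval_M0 eval_M1 lie_bracket_vert_vert[OF 0 1]
    by (simp add: M_const_def axis_def quad_def fun_eq_iff vert_def)
  show "eval_br (sys_f0 lam) sys_f1 (Br (M 1) (M 2)) = vert 0 (quad (- 12 * lam) (- 8) 0 0)"
    unfolding eval_br.simps eval_M1 eval_M2 lie_bracket_vert_vert[OF 1 2]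
    by (simp add: M_const_def axis_def quad_def fun_eq_iff vert_def algebra_simps)
  show "eval_br (sys_f0 lam) sys_f1 (Br (M 2) (M 3)) = vert 0 (quad 0 0 0 6)"
    unfolding eval_br.simps eval_M2 eval_M3 lie_bracket_vert_vert[OF 2 3]
    by (simp add: M_const_def axis_def quad_def fun_eq_iff vert_def)
qed

text \<open>The factor below is the polarised quadratic form, i.e. the second derivative of
  \<open>quad a b c d\<close> in the directions \<open>M_const i\<close> and \<open>M_const j\<close>.\<close>

lemma eval_M_M_quad:
  assumes "eval_br (sys_f0 lam) sys_f1 w = vert 0 (quad a b c d)"
  shows "eval_br (sys_f0 lam) sys_f1 (Br (M i) (Br (M j) w)) 0 =
    (let u = M_const i; v = M_const j in
      2 * a * u $ 2 * v $ 2 + b * (u $ 1 * v $ 3 + u $ 3 * v $ 1) + 2 * c * u $ 3 * v $ 3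
        + 2 * d * u $ 1 * v $ 1) *\<^sub>R axis 4 1"
proof -
  note deriv = derivative_eq_intros bounded_linear.has_derivative[OF bounded_linear_vec_nth]
  obtain f where f: "f \<in> homog 3" "eval_br (sys_f0 lam) sys_f1 (M i) = vert (M_const i) f"
    using eval_M by blast
  obtain f1 f2 f3 where df:
    "\<And>x. (f has_derivative (\<lambda>h. f1 x * h $ 1 + f2 x * h $ 2 + f3 x * h $ 3)) (at x)"
    using homog_deriv[OF f(1)] by blast
  obtain g where g: "g \<in> homog 3" "eval_br (sys_f0 lam) sys_f1 (M j) = vert (M_const j) g"
    using eval_M by blast
  obtain g1 g2 g3 where dg:
    "\<And>x. (g has_derivative (\<lambda>h. g1 x * h $ 1 + g2 x * h $ 2 + g3 x * h $ 3)) (at x)"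
    using homog_deriv[OF g(1)] by blast
  have q: "(quad a b c d has_derivative (\<lambda>h. (b * x $ 3 + 2 * d * x $ 1) * h $ 1
      + (2 * a * x $ 2) * h $ 2 + (b * x $ 1 + 2 * c * x $ 3) * h $ 3)) (at x)" for x
    unfolding quad_def[abs_def] by (auto intro!: deriv simp: algebra_simps)
  define u v where "u = M_const i" and "v = M_const j"
  have l: "((\<lambda>x. (b * x $ 3 + 2 * d * x $ 1) * v $ 1 + (2 * a * x $ 2) * v $ 2
      + (b * x $ 1 + 2 * c * x $ 3) * v $ 3) has_derivative
      (\<lambda>h. (2 * d * v $ 1 + b * v $ 3) * h $ 1 + (2 * a * v $ 2) * h $ 2
      + (b * v $ 1 + 2 * c * v $ 3) * h $ 3)) (at x)" for x :: "real^4"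
    by (auto intro!: deriv simp: algebra_simps)
  \<comment> \<open>\<open>w\<close> has constant part 0, so the vertical parts of
    \<open>M i\<close> and \<open>M j\<close> are differentiated along 0. Only the derivatives of
    the quadratic form along \<open>v\<close>, then along \<open>u\<close>, remain.\<close>
  have "eval_br (sys_f0 lam) sys_f1 (Br (M j) w) = vert 0 (\<lambda>x. (b * x $ 3 + 2 * d * x $ 1) * v $ 1
      + (2 * a * x $ 2) * v $ 2 + (b * x $ 1 + 2 * c * x $ 3) * v $ 3)"
    unfolding eval_br.simps g(2) assms lie_bracket_vert_vert[OF dg q] v_def[symmetric] by simp
  then have "eval_br (sys_f0 lam) sys_f1 (Br (M i) (Br (M j) w)) 0 = vert 0 (\<lambda>x.
      (2 * d * v $ 1 + b * v $ 3) * u $ 1 + (2 * a * v $ 2) * u $ 2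
      + (b * v $ 1 + 2 * c * v $ 3) * u $ 3) 0"
    using lie_bracket_vert_vert[OF df l, of u 0] f(2) by (simp add: u_def[symmetric])
  then show ?thesis
    by (simp add: vert_def u_def[symmetric] v_def[symmetric] Let_def algebra_simps)
qed

text \<open>Fields along the fourth axis that do not depend on the fourth coordinate
  commute.\<close>

lemma eval_Br_vertical:
  assumes "\<exists>f\<in>homog d. eval_br (sys_f0 lam) sys_f1 a = vert 0 f"
    and "\<exists>f\<in>homog e. eval_br (sys_f0 lam) sys_f1 b = vert 0 f"
  shows "eval_br (sys_f0 lam) sys_f1 (Br a b) 0 = 0"
proof -
  obtain f where f: "f \<in> homog d" "eval_br (sys_f0 lam) sys_f1 a = vert 0 f"
    using assms(1) by blast
  obtain f1 f2 f3 where df: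
    "\<And>x. (f has_derivative (\<lambda>h. f1 x * h $ 1 + f2 x * h $ 2 + f3 x * h $ 3)) (at x)"
    using homog_deriv[OF f(1)] by blast
  obtain g where g: "g \<in> homog e" "eval_br (sys_f0 lam) sys_f1 b = vert 0 g"
    using assms(2) by blast
  obtain g1 g2 g3 where dg:
    "\<And>x. (g has_derivative (\<lambda>h. g1 x * h $ 1 + g2 x * h $ 2 + g3 x * h $ 3)) (at x)"
    using homog_deriv[OF g(1)] by blast
  show ?thesis
    by (simp add: f(2) g(2) lie_bracket_vert_vert[OF df dg] vert_def)
qed

text \<open>The drift vanishes at the origin, and its differential annihilates the fourth
  axis.\<close>

lemma eval_Br_X0:
  assumes "\<exists>f\<in>homog d. eval_br (sys_f0 lam) sys_f1 a = vert 0 f"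
  shows "eval_br (sys_f0 lam) sys_f1 (Br a X0) 0 = 0"
proof -
  obtain f where f: "f \<in> homog d" "eval_br (sys_f0 lam) sys_f1 a = vert 0 f"
    using assms by blast
  obtain f1 f2 f3 where df:
    "\<And>x. (f has_derivative (\<lambda>h. f1 x * h $ 1 + f2 x * h $ 2 + f3 x * h $ 3)) (at x)"
    using homog_deriv[OF f(1)] by blast
  show ?thesis
    by (simp add: f(2) lie_bracket_vert_f0[OF df] vert_def shift_0)
qed

text \<open>The Hall condition \<open>\<lambda>(b\<^sub>2) \<le> b\<^sub>1\<close> forces brackets with few \<open>X1\<close> on the left to be right-nested.\<close>

lemma Bstar_n1_2:
  assumes "Br b1 b2 \<in> Bstar" "n1 (Br b1 b2) = 2" "b2 \<noteq> X0"
  shows "\<exists>k. b1 = M k \<and> b2 = M (Suc k)"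
proof -
  have b: "b1 \<in> Bstar" "b2 \<in> Bstar" "br_less b1 b2"
    "b2 = X1 \<or> (\<exists>c d. b2 = Br c d \<and> (br_less c b1 \<or> c = b1))"
    using assms by (auto simp: Bstar_Br_iff)
  have "b1 \<noteq> X0" using b by (simp add: br_less.simps)
  then have "n1 b1 \<ge> 1" "n1 b2 \<ge> 1" using b assms n1_pos Bstar_subset_G by blast+
  then have "n1 b1 = 1" "n1 b2 = 1" using assms(2) by simp_all
  moreover have "b1 \<in> G" "b2 \<in> G" using b Bstar_subset_G by auto
  ultimately obtain k l where kl: "b1 = M k" "b2 = M l" using n1_1_imp_M by blast
  then have "k < l" using b br_less_M by simp
  then obtain l' where l': "l = Suc l'" by (cases l) auto
  \<comment> \<open>The left factor of \<open>M l\<close> is \<open>M (l - 1)\<close>, so the Hall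
    condition reads \<open>l - 1 \<le> k\<close>, while the order gives
    \<open>k < l\<close>.\<close>
  then have "br_less (M l') (M k) \<or> M l' = M k" using b(4) kl by (auto simp: M_Suc)
  then have "l' \<le> k" using br_less_M M_inject by auto
  then have "l' = k" using l' \<open>k < l\<close> by simp
  then show ?thesis using kl l' by blast
qed

text \<open>The left factor of \<open>b\<close> does not exceed \<open>M i\<close>, and the order
  respects the number of \<open>X1\<close>, so it carries exactly one; counting then shows that the
  right factor is not \<open>X0\<close>.\<close>

lemma Bstar_n1_Suc:
  assumes "Br (M i) b \<in> Bstar" "n1 b \<ge> 2"
  shows "\<exists>c d. b = Br c d \<and> b \<in> Bstar \<and> d \<noteq> X0 \<and> (br_less c (M i) \<or> c = M i) \<and>
    n1 c = 1 \<and> Suc (n1 d) = n1 b"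
proof -
  have b: "b \<in> Bstar" "br_less (M i) b" using assms(1) by (auto simp: Bstar_Br_iff)
  obtain c d where cd: "b = Br c d" "br_less c (M i) \<or> c = M i"
    using assms by (auto simp: Bstar_Br_iff)
  have less: "c \<in> Bstar" "d \<in> Bstar" "br_less c d" using b(1) cd(1) by (auto simp: Bstar_Br_iff)
  have "c \<noteq> X0" using less by (simp add: br_less.simps)
  then have "n1 c \<ge> 1" using less n1_pos Bstar_subset_G by blast
  moreover have "n1 c \<le> 1" using cd(2) br_less_n1(1)[of c "M i"] by (auto simp: M_neq_X0 n1_M)
  ultimately have "n1 c = 1" by simp
  moreover have "d \<noteq> X0" using assms(2) cd(1) \<open>n1 c = 1\<close> by auto
  ultimately show ?thesis using b cd by auto
qed

lemma eval_nonzero_cases: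
  assumes "b \<in> Bstar" "eval_br (sys_f0 lam) sys_f1 b 0 \<noteq> 0"
  shows "b \<in> {X1, M 1, M 2, Q 1 3 3, Q 2 2 2}"
proof -
  have "b \<noteq> X0"
    using assms(2) by (auto simp: vec4_eq_iff sys_f0_nth)
  have "b \<in> G" using assms Bstar_subset_G by blast
  obtain f where f: "f \<in> homog (4 - int (n1 b))"
    "eval_br (sys_f0 lam) sys_f1 b = vert (if n1 b \<ge> 2 then 0 else M_const (nu b)) f"
    using eval_form[OF \<open>b \<in> G\<close> \<open>b \<noteq> X0\<close>] by blast
  have vertical: "\<exists>f\<in>homog (4 - int (n1 c)). eval_br (sys_f0 lam) sys_f1 c = vert 0 f"
    if "c \<in> Bstar" "n1 c \<ge> 2" for c
    using eval_form[of c lam] that Bstar_subset_G by fastforce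
  have "n1 b \<ge> 1" using n1_pos \<open>b \<in> G\<close> \<open>b \<noteq> X0\<close> by blast
  then consider "n1 b = 1" | "n1 b = 4" | "n1 b \<ge> 2" "n1 b \<noteq> 4" by linarith
  then show ?thesis
  proof cases
    case 1
    then obtain i where i: "b = M i" using n1_1_imp_M \<open>b \<in> G\<close> by blast
    have "f 0 = 0" using homog_at_0[OF f(1)] 1 by simp
    then have "M_const i \<noteq> 0" using f(2) assms(2) 1 i by (simp add: vert_def nu_M)
    then have "i = 0 \<or> i = 1 \<or> i = 2" unfolding M_const_def by metis
    then show ?thesis using i by (auto simp: M_0)
  next
    case 3
    then have "f 0 = 0" using homog_at_0[OF f(1)] homog_neg[OF f(1)] by (cases "n1 b < 4") auto
    then show ?thesis using f(2) assms(2) 3 by (simp add: vert_def)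
  next
    case 2
    then obtain b1 b2 where b: "b = Br b1 b2" by (cases b) auto
    have less: "b1 \<in> Bstar" "b2 \<in> Bstar" "br_less b1 b2" using b assms(1) by (auto simp: Bstar_Br_iff)
    then have "b1 \<noteq> X0" by (simp add: br_less.simps)
    then have n1b1: "n1 b1 \<ge> 1" using less n1_pos Bstar_subset_G by blast
    \<comment> \<open>Among the splits of four \<open>X1\<close>, the shape \<open>(a, X0)\<close>
      and 2 + 2 evaluate to 0 and the order excludes 3 + 1; only 1 + 3 is left.\<close>
    have "b2 \<noteq> X0" using eval_Br_X0[OF vertical[of b1]] assms(2) less 2 by (auto simp: b)
    have "\<not> (n1 b1 \<ge> 2 \<and> n1 b2 \<ge> 2)"
      using eval_Br_vertical[OF vertical vertical] less assms(2) b by blast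
    moreover have "n1 b1 \<le> n1 b2" using br_less_n1 less \<open>b2 \<noteq> X0\<close> by blast
    ultimately have n: "n1 b1 = 1" "n1 b2 = 3" using 2 b n1b1 by auto
    then obtain i where i: "b1 = M i" using n1_1_imp_M less Bstar_subset_G by blast
    obtain c d where cd: "b2 = Br c d" "d \<noteq> X0" "br_less c (M i) \<or> c = M i" "n1 c = 1" "n1 d = 2"
      "b2 \<in> Bstar"
      using Bstar_n1_Suc[of i b2] assms(1) n by (auto simp: b i)
    then have "c \<in> Bstar" by (simp add: Bstar_Br_iff)
    then obtain j where j: "c = M j" using n1_1_imp_M cd Bstar_subset_G by blast
    obtain e g where eg: "d = Br e g" "g \<noteq> X0" "br_less e (M j) \<or> e = M j" "d \<in> Bstar"
      using Bstar_n1_Suc[of j d] cd by (auto simp: j)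
    obtain k where k: "e = M k" "g = M (Suc k)" using Bstar_n1_2[of e g] eg cd by auto
    have "j \<le> i" "k \<le> j" using cd(3) eg(3) by (auto simp: j k br_less_M M_inject)
    \<comment> \<open>For \<open>i \<ge> 3\<close> the constant part of \<open>M i\<close> is 0, so
      both factors of \<open>b\<close> are vertical and commute.\<close>
    have "i \<le> 2"
    proof (rule ccontr)
      assume "\<not> i \<le> 2"
      then have "\<exists>f\<in>homog 3. eval_br (sys_f0 lam) sys_f1 (M i) = vert 0 f"
        using eval_M[of lam i] by (simp add: M_const_def)
      then show False using eval_Br_vertical[OF _ vertical[of b2]] less n assms(2) by (simp add: b i)
    qed
    have W: "(k = 0 \<longrightarrow> eval_br (sys_f0 lam) sys_f1 d = vert 0 (quad 0 0 2 0)) \<and>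
      (k = 1 \<longrightarrow> eval_br (sys_f0 lam) sys_f1 d = vert 0 (quad (- 12 * lam) (- 8) 0 0)) \<and>
      (k = 2 \<longrightarrow> eval_br (sys_f0 lam) sys_f1 d = vert 0 (quad 0 0 0 6))"
      using eval_W[of lam] by (auto simp: eg k numeral_2_eq_2 numeral_3_eq_3)
    have "b = Br (M i) (Br (M j) d)" by (simp add: b cd i j)
    then have nz: "eval_br (sys_f0 lam) sys_f1 (Br (M i) (Br (M j) d)) 0 \<noteq> 0" using assms by simp
    \<comment> \<open>Now \<open>k \<le> j \<le> i \<le> 2\<close>, and the polarised form decides:
      for \<open>k = 0\<close> it only sees the \<open>x $ 3\<close> direction, for
      \<open>k = 1\<close> the pair \<open>i = j = 1\<close> alone survives, and for
      \<open>k = 2\<close> it only sees \<open>x $ 1\<close>, which is out of reach.\<close>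
    consider "k = 0" | "k = 1" | "k = 2" using \<open>j \<le> i\<close> \<open>k \<le> j\<close> \<open>i \<le> 2\<close> by linarith
    then show ?thesis
    proof cases
      case 1
      with W have "eval_br (sys_f0 lam) sys_f1 d = vert 0 (quad 0 0 2 0)" by simp
      from nz[unfolded eval_M_M_quad[OF this]] have "i = 2 \<and> j = 2"
        by (auto simp: Let_def M_const_def axis_def split: if_splits)
      then show ?thesis using 1 by (simp add: b cd i j eg k Q_def P_def W_def)
    next
      case 2
      then have "j \<ge> 1" "i \<ge> 1" using \<open>j \<le> i\<close> \<open>k \<le> j\<close> by auto
      moreover from 2 W have "eval_br (sys_f0 lam) sys_f1 d = vert 0 (quad (- 12 * lam) (- 8) 0 0)"
        by simp
      note nz[unfolded eval_M_M_quad[OF this]]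
      ultimately have "i = 1 \<and> j = 1"
        by (auto simp: Let_def M_const_def axis_def split: if_splits)
      then show ?thesis using 2 by (simp add: b cd i j eg k Q_def P_def W_def numeral_2_eq_2)
    next
      case 3
      then have "j = 2" "i = 2" using \<open>j \<le> i\<close> \<open>k \<le> j\<close> \<open>i \<le> 2\<close> by auto
      moreover from 3 W have "eval_br (sys_f0 lam) sys_f1 d = vert 0 (quad 0 0 0 6)" by simp
      note nz[unfolded eval_M_M_quad[OF this]]
      ultimately show ?thesis by (auto simp: Let_def M_const_def axis_def)
    qed
  qed
qed

lemma listed_in_Bstar: "{X1, M 1, M 2, Q 1 3 3, Q 2 2 2} \<subseteq> Bstar"
proof -
  have "Br (M k) (M (Suc k)) \<in> Bstar" for k
    using M_in_Bstar[of k] M_in_Bstar[of "Suc k"] br_less_M[of k "Suc k"]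
    by (intro Bstar.intros) (auto simp: M_Suc)
  from this[of 0] this[of 1] have W: "W 1 \<in> Bstar" "W 2 \<in> Bstar"
    by (simp_all add: W_def numeral_2_eq_2)
  have less: "br_less (M i) (Br (M j) b)" if "b \<noteq> X0" "n1 b \<ge> 1" for i j b
    using that by (simp add: br_less.simps germ_M M_neq_X0 germ_less.simps n1_M)
  have n: "W j \<noteq> X0" "n1 (W j) \<ge> 1" "P j k \<noteq> X0" "n1 (P j k) \<ge> 1" for j k
    by (auto simp: W_def P_def n1_M)
  have P: "P 1 3 \<in> Bstar" "P 2 2 \<in> Bstar"
    using W M_in_Bstar less[OF _ _] br_less_M[of 0 2] M_neq_X0
    by (auto simp: P_def W_def Bstar_Br_iff[of "M _"] n1_M)
  have "Q 1 3 3 \<in> Bstar" "Q 2 2 2 \<in> Bstar"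
    using P M_in_Bstar n less by (auto simp: Q_def P_def Bstar_Br_iff[of "M _"])
  then show ?thesis using M_in_Bstar M_0 by (auto simp flip: M_0)
qed

lemma eval_listed:
  "eval_br (sys_f0 lam) sys_f1 X1 0 = axis 1 1"
  "eval_br (sys_f0 lam) sys_f1 (M 1) 0 = axis 2 1"
  "eval_br (sys_f0 lam) sys_f1 (M 2) 0 = axis 3 1"
  "eval_br (sys_f0 lam) sys_f1 (Q 1 3 3) 0 = 4 *\<^sub>R axis 4 1"
  "eval_br (sys_f0 lam) sys_f1 (Q 2 2 2) 0 = (- 24 * lam) *\<^sub>R axis 4 1"
proof -
  have "Q 1 3 3 = Br (M 2) (Br (M 2) (Br (M 0) (M 1)))" "Q 2 2 2 = Br (M 1) (Br (M 1) (Br (M 1) (M 2)))"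
    by (simp_all add: Q_def P_def W_def)
  then show "eval_br (sys_f0 lam) sys_f1 (Q 1 3 3) 0 = 4 *\<^sub>R axis 4 1"
    "eval_br (sys_f0 lam) sys_f1 (Q 2 2 2) 0 = (- 24 * lam) *\<^sub>R axis 4 1"
    by (simp_all only: eval_M_M_quad[OF eval_W(1)] eval_M_M_quad[OF eval_W(2)])
       (simp_all add: Let_def M_const_def axis_def)
qed (simp_all add: eval_M1[simplified] eval_M2 vert_def M_const_def sys_f1_def)

section \<open>Obstruction\<close>

lemma not_Wm1_STLC:
  assumes "lam \<le> 1/9"
  shows "\<not> Wm1_STLC (sys_f0 lam) sys_f1"
proof
  assume "Wm1_STLC (sys_f0 lam) sys_f1"
  then obtain \<delta> where \<delta>: "\<delta> > 0" and reach: "\<And>xs. xs \<in> ball 0 \<delta> \<Longrightarrow>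
      \<exists>u x. is_solution (sys_f0 lam) sys_f1 1 u x \<and> x 1 = xs"
    unfolding Wm1_STLC_def STLC_def by (metis zero_less_one)
  \<comment> \<open>A point of the negative fourth half-axis; half the radius puts it inside the
    ball.\<close>
  define xs :: "real^4" where "xs = (- \<delta> / 2) *\<^sub>R axis 4 1"
  have xs: "xs $ 3 = 0" "xs $ 4 < 0" using \<delta> by (simp_all add: xs_def axis_def)
  have "xs \<in> ball 0 \<delta>" using \<delta> by (simp add: xs_def)
  then obtain u x where sol: "is_solution (sys_f0 lam) sys_f1 1 u x" and x1: "x 1 = xs"
    using reach by blast
  define F where "F s = sys_f0 lam (x s) + u s *\<^sub>R sys_f1 (x s)" for s
  have cont: "continuous_on {0..1} (\<lambda>t. x t $ i)" for i
    using sol unfolding is_solution_def by (intro continuous_intros) auto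
  have "F integrable_on {0..1}"
    using sol unfolding is_solution_def F_def[abs_def] by (blast intro: set_lebesgue_integral_eq_integral)
  then have int: "F integrable_on {0..t}" if "t \<in> {0..1}" for t
    using that by (auto intro: integrable_on_subinterval)
  have x: "x t $ i = integral {0..t} (\<lambda>s. F s $ i)" if "t \<in> {0..1}" for t i
    using sol that integral_component_eq_cart[OF int[OF that], of i]
    by (simp add: is_solution_def F_def[abs_def])
  have F: "F s $ 2 = x s $ 1" "F s $ 3 = x s $ 2"
    "F s $ 4 = (x s $ 1)\<^sup>2 * (x s $ 3)\<^sup>2 - lam * (x s $ 2) ^ 4" for s
    by (simp_all add: F_def sys_f0_nth sys_f1_def axis_def)
  \<comment> \<open>\<open>x $ j\<close> is the integral of the continuous function
    \<open>x $ i\<close>, hence classically differentiable, even though the control is only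
    integrable.\<close>
  have deriv: "((\<lambda>t. x t $ j) has_real_derivative x t $ i) (at t within {0..1})"
    if "\<And>s. F s $ j = x s $ i" "t \<in> {0..1}" for i j t
    by (rule has_field_derivative_transform_within[OF
          integral_has_real_derivative[OF cont that(2)] zero_less_one that(2)])
       (simp add: x that(1))
  have d: "((\<lambda>t. x t $ 3) has_real_derivative x t $ 2) (at t within {0..1})"
    "((\<lambda>t. x t $ 2) has_real_derivative x t $ 1) (at t within {0..1})"
    if "t \<in> {0..1}" for t
    using deriv F(1,2) that by blast+
  \<comment> \<open>The derivative of \<open>x3 * x2 ^ 3\<close>, a quantity that vanishes at both
    ends because \<open>x3\<close> does.\<close>
  define D where "D t = (x t $ 2) ^ 4 + 3 * x t $ 3 * (x t $ 2)\<^sup>2 * x t $ 1" for t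
  have "((\<lambda>t. x t $ 3 * (x t $ 2) ^ 3) has_real_derivative D t) (at t within {0..1})"
    if "t \<in> {0..1}" for t
    using that by (auto intro!: derivative_eq_intros d
        simp: D_def algebra_simps power2_eq_square power3_eq_cube power4_eq_xxxx)
  then have "(D has_integral (x 1 $ 3 * (x 1 $ 2) ^ 3 - x 0 $ 3 * (x 0 $ 2) ^ 3)) {0..1}"
    by (intro fundamental_theorem_of_calculus)
       (auto simp: has_real_derivative_iff_has_vector_derivative)
  then have "(D has_integral 0) {0..1}" using x[of 0 3] by (simp add: x1 xs)
  then have "((\<lambda>t. - 2/9 * D t) has_integral - 2/9 * 0) {0..1}"
    by (rule has_integral_mult_right)
  moreover have "((\<lambda>t. F t $ 4) has_integral (xs $ 4)) {0..1}"
    using has_integral_linear[OF integrable_integral[OF int[of 1]] bounded_linear_vec_nth[of 4]]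
      x[of 1 4] x1 by (simp add: o_def integral_component_eq_cart[OF int])
  \<comment> \<open>The weight \<open>2/9\<close> completes the square: the integrand dominates
    \<open>- 2/9 * D t\<close>, whose integral is 0.\<close>
  moreover have "- 2/9 * D t \<le> F t $ 4" for t
  proof -
    have "9 * F t $ 4 + 2 * D t
      = (3 * x t $ 3 * x t $ 1 + (x t $ 2)\<^sup>2)\<^sup>2 + (1 - 9 * lam) * (x t $ 2) ^ 4"
      unfolding F D_def by (simp add: algebra_simps power2_eq_square power4_eq_xxxx)
    moreover have "\<dots> \<ge> 0" using assms by (intro add_nonneg_nonneg mult_nonneg_nonneg) auto
    ultimately show ?thesis by linarith
  qed
  ultimately have "- 2/9 * 0 \<le> xs $ 4" by (rule has_integral_le)
  then show False using xs by simp
qed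

section \<open>Smooth functions on the real line\<close>

definition smooth :: "(real \<Rightarrow> real) \<Rightarrow> bool" where
  "smooth f \<longleftrightarrow> (\<forall>k x. (deriv ^^ k) f field_differentiable at x)"

text \<open>A set of functions closed under differentiation contains all iterated derivatives of its
  members. Exhibiting such a set for each construction replaces formulas for higher
  derivatives.\<close>

lemma smooth_coinduct:
  assumes "f \<in> S"
    and "\<And>g. g \<in> S \<Longrightarrow> \<exists>g'\<in>S. \<forall>x. (g has_field_derivative g' x) (at x)"
  shows "smooth f"
proof -
  have deriv: "deriv g \<in> S" if g: "g \<in> S" for g
  proof -
    obtain g' where g': "g' \<in> S" "\<And>x. (g has_field_derivative g' x) (at x)"
      using assms(2)[OF g] by blast
    have "deriv g = g'" by (rule ext) (rule DERIV_imp_deriv[OF g'(2)])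
    then show ?thesis using g'(1) by simp
  qed
  have "(deriv ^^ k) f \<in> S" for k
    by (induction k) (use assms(1) deriv in auto)
  then show ?thesis
    unfolding smooth_def using assms(2) by (meson field_differentiable_def)
qed

lemma smooth_has_deriv: "smooth f \<Longrightarrow> (f has_field_derivative deriv f x) (at x)"
  unfolding smooth_def using DERIV_deriv_iff_field_differentiable by (metis funpow_0)

lemma smooth_deriv: "smooth f \<Longrightarrow> smooth (deriv f)"
  unfolding smooth_def by (metis funpow_simps_right(2) comp_apply)

lemma smooth_higher_deriv: "smooth f \<Longrightarrow> smooth ((deriv ^^ k) f)"
  by (induction k) (auto intro: smooth_deriv)

lemma smooth_continuous_on: "smooth f \<Longrightarrow> continuous_on A f"
  by (meson DERIV_continuous continuous_at_imp_continuous_on smooth_has_deriv)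

lemma smoothI_deriv:
  assumes "\<And>x. (f has_field_derivative g x) (at x)" "smooth g"
  shows "smooth f"
proof (rule smooth_coinduct[where S = "insert f (Collect smooth)"])
  fix h assume "h \<in> insert f (Collect smooth)"
  then consider "h = f" | "smooth h" by auto
  then show "\<exists>g'\<in>insert f (Collect smooth). \<forall>x. (h has_field_derivative g' x) (at x)"
  proof cases
    case 1 then show ?thesis using assms by (intro bexI[of _ g]) auto
  next
    case 2 then show ?thesis
      by (intro bexI[of _ "deriv h"]) (auto intro: smooth_has_deriv smooth_deriv)
  qed
qed auto

lemma smooth_const: "smooth (\<lambda>x. c)"
  by (rule smooth_coinduct[where S = "range (\<lambda>c x. c)"]) (auto intro!: derivative_eq_intros)

lemma smooth_ident: "smooth (\<lambda>x. x)"
  by (rule smoothI_deriv[of _ "\<lambda>x. 1"]) (auto intro!: derivative_eq_intros smooth_const)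

lemma smooth_add:
  assumes "smooth f" "smooth g"
  shows "smooth (\<lambda>x. f x + g x)"
proof (rule smooth_coinduct[where S = "{\<lambda>x. f x + g x | f g. smooth f \<and> smooth g}"])
  fix h assume "h \<in> {\<lambda>x. f x + g x | f g. smooth f \<and> smooth g}"
  then obtain f g where h: "h = (\<lambda>x. f x + g x)" "smooth f" "smooth g" by blast
  show "\<exists>g'\<in>{\<lambda>x. f x + g x | f g. smooth f \<and> smooth g}. \<forall>x. (h has_field_derivative g' x) (at x)"
    unfolding h(1)
    by (rule bexI[of _ "\<lambda>x. deriv f x + deriv g x"])
       (use h in \<open>auto intro!: DERIV_add smooth_has_deriv intro: smooth_deriv\<close>)
qed (use assms in blast)

text \<open>The span of the products of smooth functions is closed under differentiation.\<close>

inductive_set product_span :: "(real \<Rightarrow> real) set" where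
  prod: "smooth f \<Longrightarrow> smooth g \<Longrightarrow> (\<lambda>x. f x * g x) \<in> product_span"
| add: "p \<in> product_span \<Longrightarrow> q \<in> product_span \<Longrightarrow> (\<lambda>x. p x + q x) \<in> product_span"

lemma smooth_mult:
  assumes "smooth f" "smooth g"
  shows "smooth (\<lambda>x. f x * g x)"
proof (rule smooth_coinduct[where S = product_span])
  fix h assume "h \<in> product_span"
  then show "\<exists>h'\<in>product_span. \<forall>x. (h has_field_derivative h' x) (at x)"
  proof induction
    case (prod f g)
    then show ?case
      by (intro bexI[of _ "\<lambda>x. deriv f x * g x + f x * deriv g x"])
         (auto intro!: derivative_eq_intros smooth_has_deriv product_span.intros smooth_deriv)
  next
    case (add p q)
    then obtain p' q' where "p' \<in> product_span" "q' \<in> product_span"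
      "\<And>x. (p has_field_derivative p' x) (at x)" "\<And>x. (q has_field_derivative q' x) (at x)"
      by blast
    then show ?case
      by (intro bexI[of _ "\<lambda>x. p' x + q' x"]) (auto intro: DERIV_add product_span.add)
  qed
qed (use assms in \<open>auto intro: product_span.prod\<close>)

lemma smooth_diff:
  assumes "smooth f" "smooth g"
  shows "smooth (\<lambda>x. f x - g x)"
  using smooth_add[OF assms(1) smooth_mult[OF smooth_const[of "-1"] assms(2)]] by simp

lemma smooth_compose_affine:
  assumes "smooth f"
  shows "smooth (\<lambda>x. f (a * x + b))"
proof (rule smooth_coinduct[where S = "{\<lambda>x. f (a * x + b) | f. smooth f}"])
  fix h assume "h \<in> {\<lambda>x. f (a * x + b) | f. smooth f}"
  then obtain f where h: "h = (\<lambda>x. f (a * x + b))" "smooth f" by blast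
  have "smooth (\<lambda>x. a * deriv f x)" using h by (intro smooth_mult smooth_const smooth_deriv)
  moreover have "(h has_field_derivative a * deriv f (a * x + b)) (at x)" for x
  proof -
    have "((\<lambda>x. a * x + b) has_field_derivative a) (at x)"
      by (auto intro!: derivative_eq_intros)
    from DERIV_chain2[OF smooth_has_deriv[OF h(2)] this] show ?thesis
      unfolding h(1) by (simp add: mult.commute)
  qed
  ultimately show "\<exists>g'\<in>{\<lambda>x. f (a * x + b) | f. smooth f}. \<forall>x. (h has_field_derivative g' x) (at x)"
    by (intro bexI[of _ "\<lambda>x. a * deriv f (a * x + b)"]) auto
qed (use assms in blast)

lemma deriv_compose_affine:
  assumes "smooth f"
  shows "deriv (\<lambda>x. f (a * x + b)) = (\<lambda>x. a * deriv f (a * x + b))"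
proof
  fix x
  have "((\<lambda>x. a * x + b) has_field_derivative a) (at x)"
    by (auto intro!: derivative_eq_intros)
  from DERIV_chain2[OF smooth_has_deriv[OF assms] this]
  show "deriv (\<lambda>x. f (a * x + b)) x = a * deriv f (a * x + b)"
    by (intro DERIV_imp_deriv) (simp add: mult.commute)
qed

section \<open>Calculus of iterated derivatives\<close>

lemma higher_deriv_add:
  assumes "smooth f" "smooth g"
  shows "(deriv ^^ k) (\<lambda>x. f x + g x) = (\<lambda>x. (deriv ^^ k) f x + (deriv ^^ k) g x)"
proof (induction k)
  case (Suc k)
  have "((\<lambda>x. (deriv ^^ k) f x + (deriv ^^ k) g x) has_field_derivative
      deriv ((deriv ^^ k) f) x + deriv ((deriv ^^ k) g) x) (at x)" for x
    by (intro DERIV_add smooth_has_deriv smooth_higher_deriv assms)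
  then show ?case by (auto simp: Suc intro!: ext DERIV_imp_deriv)
qed simp

lemma higher_deriv_cmult:
  assumes "smooth f"
  shows "(deriv ^^ k) (\<lambda>x. c * f x) = (\<lambda>x. c * (deriv ^^ k) f x)"
proof (induction k)
  case (Suc k)
  have "((\<lambda>x. c * (deriv ^^ k) f x) has_field_derivative c * deriv ((deriv ^^ k) f) x) (at x)" for x
    by (intro DERIV_cmult smooth_has_deriv smooth_higher_deriv assms)
  then show ?case by (auto simp: Suc intro!: ext DERIV_imp_deriv)
qed simp

lemma higher_deriv_cong_open:
  assumes "open S" "\<And>x. x \<in> S \<Longrightarrow> f x = g x" "x \<in> S"
  shows "(deriv ^^ k) f x = (deriv ^^ k) (g :: real \<Rightarrow> real) x"
  using assms(3)
proof (induction k arbitrary: x)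
  case (Suc k)
  have "eventually (\<lambda>y. y \<in> S) (nhds x)"
    using assms(1) Suc.prems by (simp add: eventually_nhds_in_open)
  then have "eventually (\<lambda>y. (deriv ^^ k) f y = (deriv ^^ k) g y) (nhds x)"
    by eventually_elim (rule Suc.IH)
  then show ?case by (simp add: deriv_cong_ev)
qed (use assms(2) in simp)

lemma higher_deriv_zero: "(deriv ^^ k) (\<lambda>x. 0) = (\<lambda>x. 0 :: real)"
  by (induction k) auto

lemma higher_deriv_vanishes:
  fixes f :: "real \<Rightarrow> real"
  assumes "\<And>x. x \<notin> {a..b} \<Longrightarrow> f x = 0" "x \<notin> {a..b}"
  shows "(deriv ^^ k) f x = 0"
  using higher_deriv_cong_open[of "- {a..b}" f "\<lambda>_. 0" x k] assms
  by (auto simp: higher_deriv_zero)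

text \<open>Differentiating \<open>p(1/x) exp(-1/x)\<close> gives \<open>q(1/x) exp(-1/x)\<close> with \<open>q = X\<^sup>2 (p - p')\<close>.\<close>

definition flat :: "real poly \<Rightarrow> real \<Rightarrow> real" where
  "flat p x = (if x \<le> 0 then 0 else poly p (inverse x) * exp (- inverse x))"

lemma poly_exp_tendsto_0: "((\<lambda>y. poly p y * exp (- y)) \<longlongrightarrow> 0) (at_top :: real filter)"
proof -
  have *: "((\<lambda>y. coeff p i * (y ^ i / exp y)) \<longlongrightarrow> coeff p i * 0) at_top" for i :: nat
    by (intro tendsto_intros tendsto_power_div_exp_0)
  have "((\<lambda>y. \<Sum>i\<le>degree p. coeff p i * (y ^ i / exp y)) \<longlongrightarrow> (\<Sum>i\<le>degree p. coeff p i * 0)) at_top"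
    by (intro tendsto_sum *)
  then show ?thesis
    by (simp add: poly_altdef exp_minus sum_distrib_right field_simps sum_divide_distrib)
qed

lemma flat_has_deriv:
  "(flat p has_field_derivative flat ([:0, 0, 1:] * (p - pderiv p)) x) (at x)"
proof -
  consider "x < 0" | "x > 0" | "x = 0" by linarith
  then show ?thesis
  proof cases
    case 1
    have "((\<lambda>_. 0) has_field_derivative 0) (at x)" by simp
    then have "(flat p has_field_derivative 0) (at x)"
      by (rule has_field_derivative_transform_within_open[where S = "{..<0}"])
         (use 1 in \<open>auto simp: flat_def\<close>)
    then show ?thesis using 1 by (simp add: flat_def)
  next
    case 2
    have "((\<lambda>x. poly p (inverse x) * exp (- inverse x)) has_field_derivative
        flat ([:0, 0, 1:] * (p - pderiv p)) x) (at x)"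
      using 2 by (auto intro!: derivative_eq_intros DERIV_chain2[OF poly_DERIV]
          simp: flat_def algebra_simps power2_eq_square)
    then show ?thesis
      by (rule has_field_derivative_transform_within_open[where S = "{0<..}"])
         (use 2 in \<open>auto simp: flat_def\<close>)
  next
    case 3
    have "((\<lambda>h. flat p h / h) \<longlongrightarrow> 0) (at_right 0)"
    proof -
      \<comment> \<open>Dividing by \<open>h\<close> multiplies by \<open>inverse h\<close>, which
        turns \<open>p\<close> into \<open>pCons 0 p\<close>; the limit then becomes one at
        infinity.\<close>
      have "((\<lambda>h. poly (pCons 0 p) (inverse h) * exp (- inverse h)) \<longlongrightarrow> 0) (at_right (0::real))"
        by (rule filterlim_compose[OF poly_exp_tendsto_0 filterlim_inverse_at_top_right])
      moreover have "eventually (\<lambda>h::real. poly (pCons 0 p) (inverse h) * exp (- inverse h)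
          = flat p h / h) (at_right 0)"
        unfolding eventually_at_filter
        by (rule always_eventually) (auto simp: flat_def divide_inverse)
      ultimately show ?thesis by (rule Lim_transform_eventually)
    qed
    moreover have "((\<lambda>h. flat p h / h) \<longlongrightarrow> 0) (at_left 0)"
      by (rule Lim_transform_eventually[OF tendsto_const])
         (auto simp: eventually_at_filter flat_def)
    ultimately have "((\<lambda>h. flat p h / h) \<longlongrightarrow> 0) (at 0)"
      by (simp add: filterlim_split_at)
    then show ?thesis using 3 by (simp add: DERIV_def flat_def)
  qed
qed

lemma smooth_flat: "smooth (flat p)"
  by (rule smooth_coinduct[where S = "range flat"]) (use flat_has_deriv in blast)+

section \<open>A bump function and a smooth step\<close>

definition bump :: "real \<Rightarrow> real" where
  "bump x = flat 1 x * flat 1 (1 - x)"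

lemma smooth_bump: "smooth bump"
proof -
  have "smooth (\<lambda>x. flat 1 x * flat 1 ((- 1) * x + 1))"
    by (intro smooth_mult smooth_flat smooth_compose_affine)
  then show ?thesis unfolding bump_def[abs_def] by simp
qed

lemma bump_nonneg: "bump x \<ge> 0"
  and bump_eq_0: "x \<notin> {0..1} \<Longrightarrow> bump x = 0"
  and bump_half: "bump (1/2) > 0"
  by (auto simp: bump_def flat_def)

lemma integral_pos_continuous:
  fixes f :: "real \<Rightarrow> real"
  assumes "continuous_on {a..b} f" "\<And>x. x \<in> {a..b} \<Longrightarrow> f x \<ge> 0"
    and "c \<in> {a..b}" "f c > 0" "a < b"
  shows "integral {a..b} f > 0"
proof -
  have "integral {a..b} f \<ge> 0" using assms(2) by (intro integral_nonneg integrable_continuous_real assms(1)) auto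
  moreover have "integral {a..b} f \<noteq> 0"
    using integral_eq_0_iff[OF assms(1) \<open>a < b\<close>] assms by force
  ultimately show ?thesis by linarith
qed

text \<open>The normalised primitive of the bump is such a step.\<close>

lemma smooth_step_exists:
  "\<exists>f. smooth f \<and> (\<forall>x\<le>0. f x = 0) \<and> (\<forall>x\<ge>1. f x = 1)"
proof -
  define c where "c = integral {0..1} bump"
  have c: "c > 0"
    unfolding c_def using bump_nonneg bump_half
    by (intro integral_pos_continuous[where c = "1/2"] smooth_continuous_on smooth_bump) auto
  define F where "F x = (if x \<ge> 0 then integral {0..x} bump else 0)" for x
  have bump_int: "bump integrable_on {a..b}" for a b
    by (intro integrable_continuous_real smooth_continuous_on smooth_bump)
  have F1: "F x = c" if "x \<ge> 1" for x
  proof -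
    have "integral {0..1} bump + integral {1..x} bump = integral {0..x} bump"
      using that by (intro Henstock_Kurzweil_Integration.integral_combine bump_int) auto
    moreover have "integral {1..x} bump = integral {1..x} (\<lambda>_. 0)"
      by (rule integral_spike[of "{1}"]) (auto simp: bump_eq_0)
    ultimately show ?thesis using that by (simp add: F_def c_def)
  qed
  \<comment> \<open>Moving the base point to \<open>-L\<close> makes every real point, in particular
    0, interior to an interval on which \<open>F\<close> is an integral with variable upper
    end.\<close>
  have F: "F x = integral {-L..x} bump" if "x \<ge> -L" "L > 0" for x L
  proof -
    have *: "integral {-L..y} bump = 0" if "y \<le> 0" for y
    proof -
      have "integral {-L..y} bump = integral {-L..y} (\<lambda>_. 0)"
        by (rule integral_spike[of "{0}"]) (use that in \<open>auto simp: bump_eq_0\<close>)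
      then show ?thesis by simp
    qed
    show ?thesis
    proof (cases "x \<ge> 0")
      case True
      have "integral {-L..0} bump + integral {0..x} bump = integral {-L..x} bump"
        using that True by (intro Henstock_Kurzweil_Integration.integral_combine bump_int) auto
      then show ?thesis using True *[of 0] by (simp add: F_def)
    next
      case False then show ?thesis using *[of x] by (simp add: F_def)
    qed
  qed
  have dF: "(F has_field_derivative bump x) (at x)" for x
  proof -
    define L where "L = \<bar>x\<bar> + 1"
    have L: "-L < x" "x < L" "L > 0" by (auto simp: L_def)
    have "((\<lambda>u. integral {-L..u} bump) has_vector_derivative bump x) (at x within {-L..L})"
      using L by (intro integral_has_vector_derivative smooth_continuous_on smooth_bump) auto
    then have "((\<lambda>u. integral {-L..u} bump) has_field_derivative bump x) (at x)"
      using L at_within_interior[of x "{-L..L}"]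
      by (simp add: has_real_derivative_iff_has_vector_derivative)
    then show ?thesis
      by (rule has_field_derivative_transform_within_open[where S = "{-L<..<L}"])
         (use L F[of L] in auto)
  qed
  show ?thesis
  proof (intro exI[of _ "\<lambda>x. inverse c * F x"] conjI allI impI)
    show "smooth (\<lambda>x. inverse c * F x)"
      by (intro smooth_mult smooth_const smoothI_deriv[OF dF] smooth_bump)
    show "inverse c * F x = 1" if "1 \<le> x" for x using F1[OF that] c by simp
    show "inverse c * F x = 0" if "x \<le> 0" for x using that by (simp add: F_def)
  qed
qed

text \<open>Differentiating \<open>s\<^sup>a v(ln s)\<close> gives \<open>s\<^bsup>a-1\<^esup> (a v + v')(ln s)\<close>.\<close>

definition powr_log :: "real \<Rightarrow> (real \<Rightarrow> real) \<Rightarrow> real \<Rightarrow> real" where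
  "powr_log a v s = (if s \<le> 0 then 0 else s powr a * v (ln s))"

lemma powr_log_has_deriv:
  assumes v: "smooth v" "\<And>x. x < L \<Longrightarrow> v x = 0"
  shows "(powr_log a v has_field_derivative powr_log (a - 1) (\<lambda>x. a * v x + deriv v x) s) (at s)"
proof (cases "s > 0")
  case True
  have "((\<lambda>s. s powr a * v (ln s)) has_field_derivative
      a * s powr (a - 1) * v (ln s) + s powr a * (deriv v (ln s) * inverse s)) (at s)"
    using True by (auto intro!: derivative_eq_intros DERIV_chain2[OF smooth_has_deriv[OF v(1)]]
      simp: divide_inverse)
  moreover have "s powr (a - 1) = s powr a * inverse s"
    using True by (simp add: powr_diff divide_inverse)
  ultimately have "((\<lambda>s. s powr a * v (ln s)) has_field_derivative
      powr_log (a - 1) (\<lambda>x. a * v x + deriv v x) s) (at s)"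
    using True by (simp add: powr_log_def distrib_left mult_ac)
  then show ?thesis
    by (rule has_field_derivative_transform_within_open[where S = "{0<..}"])
       (use True in \<open>auto simp: powr_log_def\<close>)
next
  case False
  \<comment> \<open>\<open>v\<close> vanishes below \<open>L\<close>, so the function is zero on the
    half-line below \<open>exp L\<close>, a neighbourhood of every \<open>s \<le> 0\<close>.\<close>
  have "powr_log a v t = 0" if "t < exp L" for t
  proof (cases "t > 0")
    case True
    then have "ln t < L" using that ln_less_cancel_iff[of t "exp L"] by simp
    then show ?thesis using v(2) by (simp add: powr_log_def)
  qed (simp add: powr_log_def)
  then have "(powr_log a v has_field_derivative 0) (at s)"
    using False le_less_trans[of s 0 "exp L"]
    by (intro has_field_derivative_transform_within_open[OF DERIV_const[of 0], where S = "{..<exp L}"])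
       auto
  then show ?thesis using False by (simp add: powr_log_def)
qed

text \<open>The family is closed under differentiation: the new profile \<open>a v + v'\<close>
  vanishes below the same \<open>L\<close>.\<close>

lemma smooth_powr_log:
  assumes "smooth v" "\<And>x. x < L \<Longrightarrow> v x = 0"
  shows "smooth (powr_log a v)"
proof (rule smooth_coinduct[where S = "{powr_log a v | a v. smooth v \<and> (\<forall>x<L. v x = 0)}"])
  fix g assume "g \<in> {powr_log a v | a v. smooth v \<and> (\<forall>x<L. v x = 0)}"
  then obtain a v where g: "g = powr_log a v" "smooth v" "\<And>x. x < L \<Longrightarrow> v x = 0" by blast
  have "deriv v x = 0" if "x < L" for x
    using higher_deriv_cong_open[of "{..<L}" v "\<lambda>_. 0" x 1] g(3) that by simp
  then have "powr_log (a - 1) (\<lambda>x. a * v x + deriv v x) \<in> {powr_log a v | a v. smooth v \<and> (\<forall>x<L. v x = 0)}"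
    using g by (intro CollectI exI[of _ "a - 1"] exI[of _ "\<lambda>x. a * v x + deriv v x"] conjI)
      (auto intro!: smooth_add smooth_mult smooth_const smooth_deriv)
  then show "\<exists>g'\<in>{powr_log a v | a v. smooth v \<and> (\<forall>x<L. v x = 0)}. \<forall>x. (g has_field_derivative g' x) (at x)"
    unfolding g(1) using powr_log_has_deriv[OF g(2,3)] by blast
qed (use assms in auto)

section \<open>Smooth controls and their trajectories\<close>

lemma Linf_norm_le:
  assumes "continuous_on {0<..<T} v" "\<And>t. t \<in> {0<..<T} \<Longrightarrow> \<bar>v t\<bar> \<le> B"
  shows "Linf_norm T v \<le> ereal B"
proof -
  have "v \<in> borel_measurable (lebesgue_on {0<..<T})"
    by (rule continuous_imp_measurable_on_sets_lebesgue[OF assms(1)]) simp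
  then have "(\<lambda>t. ereal \<bar>v t\<bar>) \<in> borel_measurable (lebesgue_on {0<..<T})" by measurable
  moreover have "AE t in lebesgue_on {0<..<T}. ereal \<bar>v t\<bar> \<le> ereal B"
    by (rule AE_I2) (use assms(2) in auto)
  ultimately show ?thesis unfolding Linf_norm_def by (rule esssup_I)
qed

lemma smooth_L1_loc: "smooth u \<Longrightarrow> u \<in> L1_loc T"
  unfolding L1_loc_def by (auto intro!: absolutely_integrable_continuous_real smooth_continuous_on)

lemma test_functions_smooth: "\<phi> \<in> test_functions T \<Longrightarrow> smooth \<phi>"
  unfolding test_functions_def smooth_def by blast

lemma test_functions_boundary:
  assumes "\<phi> \<in> test_functions T"
  shows "(deriv ^^ k) \<phi> 0 = 0" "(deriv ^^ k) \<phi> T = 0"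
proof -
  obtain a b where "0 < a" "b < T" "\<And>x. x \<notin> {a..b} \<Longrightarrow> \<phi> x = 0"
    using assms unfolding test_functions_def by blast
  then show "(deriv ^^ k) \<phi> 0 = 0" "(deriv ^^ k) \<phi> T = 0"
    using higher_deriv_vanishes[of a b \<phi>] by auto
qed

text \<open>Repeated integration by parts; the boundary terms vanish since all derivatives of a test
  function are zero at 0 and \<open>T\<close>.\<close>

lemma weak_deriv_smooth:
  assumes "smooth u" "T > 0"
  shows "weak_deriv T k u ((deriv ^^ k) u)"
proof -
  have "integral {0..T} (\<lambda>t. u t * (deriv ^^ k) \<phi> t) = (-1) ^ k * integral {0..T} (\<lambda>t. (deriv ^^ k) u t * \<phi> t)"
    if \<phi>: "\<phi> \<in> test_functions T" for \<phi>
    using assms(1)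
  proof (induction k arbitrary: u)
    case (Suc k)
    have \<phi>_smooth: "smooth ((deriv ^^ k) \<phi>)"
      using \<phi> by (intro smooth_higher_deriv test_functions_smooth)
    have "((\<lambda>t. u t * (deriv ^^ k) \<phi> t) has_real_derivative
        deriv u t * (deriv ^^ k) \<phi> t + u t * (deriv ^^ Suc k) \<phi> t) (at t within {0..T})" for t
      using DERIV_mult[OF smooth_has_deriv[OF Suc.prems] smooth_has_deriv[OF \<phi>_smooth], of t]
      by (simp add: has_field_derivative_at_within mult.commute add.commute)
    then have "((\<lambda>t. deriv u t * (deriv ^^ k) \<phi> t + u t * (deriv ^^ Suc k) \<phi> t) has_integral
        (u T * (deriv ^^ k) \<phi> T - u 0 * (deriv ^^ k) \<phi> 0)) {0..T}"
      using assms(2) by (intro fundamental_theorem_of_calculus)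
        (auto simp: has_real_derivative_iff_has_vector_derivative)
    then have "integral {0..T} (\<lambda>t. deriv u t * (deriv ^^ k) \<phi> t + u t * (deriv ^^ Suc k) \<phi> t) = 0"
      using test_functions_boundary[OF \<phi>, of k] by (simp add: has_integral_iff)
    moreover have "(\<lambda>t. deriv u t * (deriv ^^ k) \<phi> t) integrable_on {0..T}"
      "(\<lambda>t. u t * (deriv ^^ Suc k) \<phi> t) integrable_on {0..T}"
      by (intro integrable_continuous_real smooth_continuous_on smooth_mult smooth_deriv Suc.prems
          smooth_higher_deriv test_functions_smooth[OF \<phi>])+
    ultimately have "integral {0..T} (\<lambda>t. u t * (deriv ^^ Suc k) \<phi> t)
        = - integral {0..T} (\<lambda>t. deriv u t * (deriv ^^ k) \<phi> t)"
      by (simp add: Henstock_Kurzweil_Integration.integral_add)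
    then show ?case
      using Suc.IH[OF smooth_deriv[OF Suc.prems]]
      by (simp del: funpow.simps add: funpow_Suc_right)
  qed simp
  then show ?thesis
    using assms unfolding weak_deriv_def integral_open_interval_real
    by (simp add: smooth_L1_loc smooth_higher_deriv)
qed

text \<open>Support strictly inside the interval gives the boundary conditions, with the iterated
  derivatives as continuous representatives. The factor \<open>real m + 1\<close> counts the orders
  from 0 to \<open>m\<close>.\<close>

lemma Winf0_smooth:
  assumes u: "smooth u" "\<And>t. t \<notin> {a..b} \<Longrightarrow> u t = 0" and ab: "0 < a" "b < T" "T > 0"
    and B: "\<And>k t. k \<le> m \<Longrightarrow> t \<in> {0<..<T} \<Longrightarrow> \<bar>(deriv ^^ k) u t\<bar> \<le> B"
  shows "u \<in> Winf0 m T" "Winf_norm m T u \<le> ereal ((real m + 1) * B)"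
proof -
  have weak: "weak_deriv T k u ((deriv ^^ k) u)" for k
    using u ab by (intro weak_deriv_smooth)
  have cont: "continuous_on A ((deriv ^^ k) u)" for k A
    using u by (intro smooth_continuous_on smooth_higher_deriv)
  have norm: "Linf_norm T ((deriv ^^ k) u) \<le> ereal B" if "k \<le> m" for k
    using B[OF that] by (intro Linf_norm_le cont) auto
  have "Linf_norm T ((deriv ^^ k) u) < \<infinity>" if "k \<le> m" for k
    using norm[OF that] by (rule le_less_trans) simp
  then have Winf: "u \<in> Winf m T"
    unfolding Winf_def using weak by simp blast
  have "(deriv ^^ k) u 0 = 0" "(deriv ^^ k) u T = 0" for k
    using higher_deriv_vanishes[where x = 0, OF u(2)] higher_deriv_vanishes[where x = T, OF u(2)] ab
    by simp_all
  then have "\<exists>w. weak_deriv T k u w \<and> continuous_on {0..T} w \<and> w 0 = 0 \<and> w T = 0" for k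
    using weak[of k] cont[of "{0..T}" k] by (intro exI[of _ "(deriv ^^ k) u"]) simp
  then show "u \<in> Winf0 m T" unfolding Winf0_def using Winf by simp
  have "(INF v\<in>{v. weak_deriv T k u v}. Linf_norm T v) \<le> ereal B" if "k \<le> m" for k
    by (rule INF_lower2[of "(deriv ^^ k) u"]) (simp_all add: weak norm[OF that])
  then have "Winf_norm m T u \<le> (\<Sum>k\<le>m. ereal B)"
    unfolding Winf_norm_def by (intro sum_mono) simp
  also have "\<dots> = ereal (\<Sum>k\<le>m. B)" by (rule sum_ereal)
  also have "\<dots> = ereal ((real m + 1) * B)" by simp
  finally show "Winf_norm m T u \<le> ereal ((real m + 1) * B)" .
qed

text \<open>The fourth component of the drift along a trajectory with third coordinate
  \<open>f\<close>.\<close>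

definition action :: "real \<Rightarrow> (real \<Rightarrow> real) \<Rightarrow> real \<Rightarrow> real" where
  "action lam f s = (deriv (deriv f) s)\<^sup>2 * (f s)\<^sup>2 - lam * (deriv f s) ^ 4"

lemma continuous_on_action: "smooth f \<Longrightarrow> continuous_on A (action lam f)"
  unfolding action_def[abs_def] by (intro continuous_intros smooth_continuous_on smooth_deriv)

lemma deriv_cmult_smooth: "smooth f \<Longrightarrow> deriv (\<lambda>s. c * f s) = (\<lambda>s. c * deriv f s)"
  using higher_deriv_cmult[of f 1 c] by simp

lemma deriv_add_smooth:
  "smooth f \<Longrightarrow> smooth g \<Longrightarrow> deriv (\<lambda>s. f s + g s) = (\<lambda>s. deriv f s + deriv g s)"
  using higher_deriv_add[of f g 1] by simp

lemma action_cmult: "smooth f \<Longrightarrow> action lam (\<lambda>s. c * f s) s = c ^ 4 * action lam f s"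
  by (simp add: action_def deriv_cmult_smooth smooth_deriv)
    (simp add: power2_eq_square power4_eq_xxxx algebra_simps)

lemma action_add_disjoint:
  assumes "smooth f" "smooth g"
    and "(f s = 0 \<and> deriv f s = 0 \<and> deriv (deriv f) s = 0) \<or>
      (g s = 0 \<and> deriv g s = 0 \<and> deriv (deriv g) s = 0)"
  shows "action lam (\<lambda>s. f s + g s) s = action lam f s + action lam g s"
  using assms by (auto simp: action_def deriv_add_smooth smooth_deriv)

lemma continuous_on_vec4:
  fixes f :: "real \<Rightarrow> real^4"
  shows "continuous_on A f \<longleftrightarrow> continuous_on A (\<lambda>x. f x $ 1) \<and> continuous_on A (\<lambda>x. f x $ 2) \<and>
    continuous_on A (\<lambda>x. f x $ 3) \<and> continuous_on A (\<lambda>x. f x $ 4)"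
proof -
  have "continuous_on A f \<longleftrightarrow> (\<forall>i. continuous_on A (\<lambda>x. f x $ i))"
    using continuous_on_vec_lambda[of A "\<lambda>i x. f x $ i"]
    by (auto intro: continuous_on_component)
  then show ?thesis by (simp add: forall_4)
qed

text \<open>The third coordinate determines the first two by differentiation and the control as its
  third derivative; the fourth is then a quadrature.\<close>

lemma is_solution_smooth:
  assumes f: "smooth f" "f 0 = 0" "deriv f 0 = 0" "deriv (deriv f) 0 = 0" and "T > 0"
  shows "is_solution (sys_f0 lam) sys_f1 T (deriv (deriv (deriv f)))
    (\<lambda>t. vector [deriv (deriv f) t, deriv f t, f t, integral {0..t} (action lam f)])"
    (is "is_solution _ _ _ ?u ?x")
proof -
  define F where "F s = sys_f0 lam (?x s) + ?u s *\<^sub>R sys_f1 (?x s)" for s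
  have x_nth: "?x t $ 1 = deriv (deriv f) t" "?x t $ 2 = deriv f t" "?x t $ 3 = f t"
    "?x t $ 4 = integral {0..t} (action lam f)" for t
    by (simp_all add: vector_def)
  have F_nth: "F t $ 1 = ?u t" "F t $ 2 = deriv (deriv f) t" "F t $ 3 = deriv f t"
    "F t $ 4 = action lam f t" for t
    by (simp_all only: F_def vector_add_component vector_scaleR_component sys_f0_nth x_nth)
       (simp_all add: sys_f1_def axis_def action_def)
  have smooth: "smooth (deriv f)" "smooth (deriv (deriv f))" "smooth ?u"
    using f(1) smooth_deriv by blast+
  have cF: "continuous_on {0..T} F"
    using f(1) smooth
    by (auto simp: continuous_on_vec4 F_nth intro: smooth_continuous_on continuous_on_action)
  have "integral {0..t} ?u = deriv (deriv f) t" "integral {0..t} (deriv (deriv f)) = deriv f t"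
    "integral {0..t} (deriv f) = f t" if "t \<ge> 0" for t
  proof -
    have "integral {0..t} (deriv g) = g t - g 0" if "smooth g" for g
      using smooth_has_deriv[OF that] \<open>t \<ge> 0\<close>
      by (intro integral_unique fundamental_theorem_of_calculus)
         (auto simp: has_real_derivative_iff_has_vector_derivative
           intro: has_vector_derivative_at_within)
    then show "integral {0..t} ?u = deriv (deriv f) t" "integral {0..t} (deriv (deriv f)) = deriv f t"
      "integral {0..t} (deriv f) = f t"
      using f smooth by simp_all
  qed
  moreover have "integral {0..t} F $ i = integral {0..t} (\<lambda>s. F s $ i)" if "t \<in> {0..T}" for i t
    using that integrable_continuous_real[OF continuous_on_subset[OF cF]]
    by (intro integral_component_eq_cart[symmetric]) auto
  ultimately have x_int: "?x t = integral {0..t} F" if "t \<in> {0..T}" for t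
    using that by (simp only: vec4_eq_iff x_nth F_nth) auto
  have "continuous_on {0..T} (\<lambda>t. integral {0..t} F)"
    by (intro indefinite_integral_continuous_1 integrable_continuous_real cF)
  then have "continuous_on {0..T} ?x"
    by (rule continuous_on_eq) (simp add: x_int)
  then show ?thesis
    unfolding is_solution_def F_def[symmetric]
    using cF x_int by (auto intro: absolutely_integrable_continuous_real)
qed

lemma action_affine:
  assumes "smooth f"
  shows "action lam (\<lambda>s. f (p * s + q)) s = p ^ 4 * action lam f (p * s + q)"
proof -
  have "deriv (\<lambda>s. f (p * s + q)) = (\<lambda>s. p * deriv f (p * s + q))"
    by (rule deriv_compose_affine[OF assms])
  moreover have "deriv (\<lambda>s. p * deriv f (p * s + q)) = (\<lambda>s. p * (p * deriv (deriv f) (p * s + q)))"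
    by (simp add: deriv_cmult_smooth smooth_compose_affine smooth_deriv assms deriv_compose_affine)
  ultimately show ?thesis
    by (simp add: action_def algebra_simps power2_eq_square power4_eq_xxxx)
qed

text \<open>Each term of the integrand contains four derivatives, hence a factor
  \<open>p ^ 4\<close>, and the substitution contributes \<open>1 / p\<close>. The sign of the
  integral survives.\<close>

lemma action_affine_has_integral:
  assumes "smooth f" "(action lam f has_integral I) {a..b}" "p > 0"
  shows "(action lam (\<lambda>s. f (p * s + q)) has_integral p ^ 3 * I) {(a - q) / p..(b - q) / p}"
proof -
  have "((\<lambda>s. action lam f (p * s + q)) has_integral (1 / p) * I)
      ((\<lambda>x. (1 / p) * x + - ((1 / p) * q)) ` {a..b})"
    using has_integral_affinity[of "action lam f" I a b p q] assms by simp
  moreover have "(\<lambda>x. (1 / p) * x + - ((1 / p) * q)) ` {a..b} = {(a - q) / p..(b - q) / p}"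
    using assms(3)
    by (subst image_affinity_atLeastAtMost) (auto simp: diff_divide_distrib divide_le_cancel)
  ultimately have "((\<lambda>s. p ^ 4 * action lam f (p * s + q)) has_integral p ^ 4 * ((1 / p) * I))
      {(a - q) / p..(b - q) / p}"
    by (intro has_integral_mult_right) simp
  moreover have "p ^ 4 * ((1 / p) * I) = p ^ 3 * I"
    using assms(3) by (simp add: power4_eq_xxxx power3_eq_cube)
  moreover have "action lam (\<lambda>s. f (p * s + q)) = (\<lambda>s. p ^ 4 * action lam f (p * s + q))"
    using action_affine[OF assms(1)] by blast
  ultimately show ?thesis by simp
qed

text \<open>The integral depends continuously on \<open>e\<close>, so its positivity at
  \<open>e = 0\<close> persists for small parameters.\<close>

lemma eventually_integral_pos:
  fixes G :: "real \<Rightarrow> real \<Rightarrow> real"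
  assumes "continuous_on ({0..1} \<times> {0..1}) (\<lambda>(e, s). G e s)" "integral {0..1} (G 0) > 0"
  shows "\<exists>e>0. integral {0..1} (G e) > 0"
proof -
  have "continuous_on {0..1} (\<lambda>e. integral (cbox 0 1) (G e))"
    by (rule integral_continuous_on_param) (use assms(1) in simp)
  then have "((\<lambda>e. integral {0..1} (G e)) \<longlongrightarrow> integral {0..1} (G 0)) (at 0 within {0..1})"
    by (simp add: continuous_on)
  then have "eventually (\<lambda>e. integral {0..1} (G e) > 0) (at 0 within {0..1})"
    using assms(2) by (rule order_tendstoD)
  then obtain d where d: "d > 0" "\<And>e. e \<in> {0..1} \<Longrightarrow> e \<noteq> 0 \<Longrightarrow> dist e 0 < d \<Longrightarrow> integral {0..1} (G e) > 0"
    unfolding eventually_at by blast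
  show ?thesis
    by (rule exI[of _ "min 1 (d / 2)"]) (use d in auto)
qed

section \<open>Motions along the fourth axis\<close>

text \<open>The profile \<open>s\<^bsup>3/4\<^esup>\<close> makes \<open>f\<^sup>2 f''\<^sup>2\<close> and \<open>f'\<^sup>4\<close> both proportional to \<open>1/s\<close>, with ratio \<open>1/9\<close>;
  a cut-off that is slowly varying in \<open>ln s\<close> only perturbs this ratio.\<close>

lemma action_neg_exists:
  assumes "lam > 1/9"
  shows "\<exists>f a b I. smooth f \<and> (\<forall>x. x \<notin> {a..b} \<longrightarrow> f x = 0) \<and>
    (action lam f has_integral I) {a..b} \<and> I < 0"
proof -
  \<comment> \<open>For \<open>f = s^(3/4) bump(e ln s)\<close> this is minus \<open>s\<close> times
    the integrand, at \<open>t = e ln s\<close>. The coefficients are \<open>3/4\<close>,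
    \<open>- 3/16 = 3/4 * (- 1/4)\<close> and \<open>1/2 = 3/4 - 1/4\<close>.\<close>
  define G where "G e t = lam * (3/4 * bump t + e * deriv bump t) ^ 4 - (bump t)\<^sup>2 *
    (- 3/16 * bump t + e * (1/2 * deriv bump t) + e\<^sup>2 * deriv (deriv bump) t)\<^sup>2" for e t
  have cont: "continuous_on A bump" "continuous_on A (deriv bump)" "continuous_on A (deriv (deriv bump))" for A
    by (intro smooth_continuous_on smooth_deriv smooth_bump)+
  have snd: "continuous_on A (\<lambda>p. h (snd p))" if "continuous_on UNIV h" for A :: "(real \<times> real) set" and h :: "real \<Rightarrow> real"
    using continuous_on_compose2[OF that continuous_on_snd[OF continuous_on_id]] by simp
  have "continuous_on ({0..1} \<times> {0..1}) (\<lambda>p. G (fst p) (snd p))"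
    unfolding G_def by (intro continuous_intros snd cont)
  moreover have "integral {0..1} (G 0) > 0"
  proof (rule integral_pos_continuous[of 0 1 "G 0" "1/2"])
    \<comment> \<open>At \<open>e = 0\<close> the comparison is between
      \<open>lam * (3/4) ^ 4\<close> and \<open>(3/16) ^ 2\<close>, with balance at
      \<open>1/9\<close>.\<close>
    have G0: "G 0 t = (81 * lam - 9) / 256 * bump t ^ 4" for t
      by (simp add: G_def field_simps power2_eq_square power4_eq_xxxx)
    show "G 0 t \<ge> 0" for t using assms by (simp add: G0)
    show "G 0 (1/2) > 0" using assms bump_half unfolding G0 by (intro mult_pos_pos) auto
    show "continuous_on {0..1} (G 0)"
      unfolding G_def[abs_def] by (intro continuous_intros cont)
  qed auto
  ultimately obtain e where e: "e > 0" "integral {0..1} (G e) > 0"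
    using eventually_integral_pos[of G] by (auto simp: case_prod_beta)
  \<comment> \<open>Profiles of \<open>f\<close>, \<open>f'\<close> and \<open>f''\<close> as
    functions of \<open>ln s\<close>, to be multiplied by the powers \<open>3/4\<close>,
    \<open>- 1/4\<close> and \<open>- 5/4\<close> of \<open>s\<close>.\<close>
  define w where "w t = bump (e * t)" for t
  define w1 where "w1 = (\<lambda>t. 3/4 * w t + e * deriv bump (e * t))"
  define w2 where "w2 = (\<lambda>t. - 3/16 * w t + e * (1/2 * deriv bump (e * t)) + e\<^sup>2 * deriv (deriv bump) (e * t))"
  have smooth: "smooth w" "smooth (\<lambda>t. deriv bump (e * t))" "smooth (\<lambda>t. deriv (deriv bump) (e * t))"
    using smooth_compose_affine[of _ e 0] smooth_bump smooth_deriv by (simp_all add: w_def[abs_def])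
  have dw: "deriv w = (\<lambda>t. e * deriv bump (e * t))"
    "deriv (\<lambda>t. deriv bump (e * t)) = (\<lambda>t. e * deriv (deriv bump) (e * t))"
    using deriv_compose_affine[of bump e 0] deriv_compose_affine[of "deriv bump" e 0]
    by (simp_all add: w_def[abs_def] smooth_bump smooth_deriv)
  have w1: "w1 = (\<lambda>t. 3/4 * w t + deriv w t)" by (simp add: w1_def dw)
  have smooth_w1: "smooth w1" unfolding w1_def by (intro smooth_add smooth_mult smooth_const smooth)
  have "(w1 has_real_derivative 3/4 * deriv w t + e * deriv (\<lambda>t. deriv bump (e * t)) t) (at t)" for t
    unfolding w1_def by (intro DERIV_add DERIV_cmult smooth_has_deriv smooth)
  then have dw1: "deriv w1 = (\<lambda>t. 3/4 * (e * deriv bump (e * t)) + e * (e * deriv (deriv bump) (e * t)))"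
    unfolding dw by (intro ext DERIV_imp_deriv)
  have w2: "w2 = (\<lambda>t. (3/4 - 1) * w1 t + deriv w1 t)"
    unfolding w2_def dw1 by (simp add: fun_eq_iff w1_def algebra_simps power2_eq_square)
  have w0: "w t = 0" if "t < 0" for t
    using bump_eq_0[of "e * t"] mult_pos_neg[OF e(1) that] by (simp add: w_def)
  have w10: "w1 t = 0" if "t < 0" for t
  proof -
    have "deriv w t = 0"
      using higher_deriv_cong_open[of "{..<0}" w "\<lambda>_. 0" t 1] w0 that by simp
    then show ?thesis using w0[OF that] by (simp add: w1)
  qed
  define f where "f = powr_log (3/4) w"
  have smooth_f: "smooth f" unfolding f_def by (rule smooth_powr_log[of _ 0]) (use smooth w0 in auto)
  have d1: "deriv f = powr_log (- 1/4) w1"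
    unfolding f_def w1 by (rule ext, rule DERIV_imp_deriv)
      (use powr_log_has_deriv[of w 0 "3/4"] smooth w0 in simp)
  have d2: "deriv (deriv f) = powr_log (- 5/4) w2"
    unfolding d1 w2 by (rule ext, rule DERIV_imp_deriv)
      (use powr_log_has_deriv[of w1 0 "- 1/4"] smooth_w1 w10 in simp)
  have f0: "f s = 0" if "s \<notin> {1..exp (1/e)}" for s
  proof (cases "s > 0")
    case True
    then have "e * ln s < 0 \<or> e * ln s > 1"
      using that e ln_less_cancel_iff[of "exp (1/e)" s] by (auto simp: mult_less_0_iff field_simps)
    then show ?thesis by (auto simp: f_def powr_log_def w_def bump_eq_0)
  qed (simp add: f_def powr_log_def)
  \<comment> \<open>The exponents add up to \<open>2 * 3/4 - 2 * 5/4 = - 1\<close> and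
    \<open>4 * (- 1/4) = - 1\<close>, so \<open>1 / s\<close> comes out: up to \<open>e\<close>, the
    Jacobian of \<open>t = e * ln s\<close>.\<close>
  have act: "action lam f s = - 1 / e * ((e / s) *\<^sub>R G e (e * ln s))" if "s > 0" for s
  proof -
    have "s powr (3/4) * s powr (3/4) * (s powr (- 5/4) * s powr (- 5/4)) = inverse s"
      "s powr (- 1/4) * s powr (- 1/4) * (s powr (- 1/4) * s powr (- 1/4)) = inverse s"
      using that powr_minus[of s 1] by (simp_all flip: powr_add)
    then have *: "(s powr (3/4))\<^sup>2 * (s powr (- 5/4))\<^sup>2 = inverse s" "(s powr (- 1/4)) ^ 4 = inverse s"
      by (simp_all add: power2_eq_square power4_eq_xxxx mult.assoc)
    have "action lam f s = ((s powr (3/4))\<^sup>2 * (s powr (- 5/4))\<^sup>2) * ((w2 (ln s))\<^sup>2 * (w (ln s))\<^sup>2)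
        - lam * ((s powr (- 1/4)) ^ 4 * w1 (ln s) ^ 4)"
      unfolding action_def unfolding d2 unfolding d1 using that
      by (simp add: f_def powr_log_def power_mult_distrib)
    also have "\<dots> = - (inverse s * G e (e * ln s))"
      unfolding * by (simp add: G_def w_def w1_def w2_def algebra_simps)
    finally show ?thesis using e by (simp add: divide_inverse)
  qed
  have "((\<lambda>s. (e / s) *\<^sub>R G e (e * ln s)) has_integral (integral {e * ln 1..e * ln (exp (1/e))} (G e))) {1..exp (1/e)}"
  proof (rule has_integral_substitution[where c = 0 and d = 1])
    show "continuous_on {0..1} (G e)" unfolding G_def[abs_def] by (intro continuous_intros cont)
    show "((\<lambda>s. e * ln s) has_real_derivative e / s) (at s within {1..exp (1/e)})" if "s \<in> {1..exp (1/e)}" for s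
      using that by (auto intro!: derivative_eq_intros)
    have "ln s \<le> 1/e" if "1 \<le> s" "s \<le> exp (1/e)" for s
      using that by (metis ln_exp ln_le_cancel_iff exp_gt_zero less_le_trans zero_less_one)
    then show "(\<lambda>s. e * ln s) ` {1..exp (1/e)} \<subseteq> {0..1}"
      using e by (auto simp: field_simps)
  qed (use e in auto)
  then have "((\<lambda>s. - 1 / e * ((e / s) *\<^sub>R G e (e * ln s))) has_integral - 1 / e * integral {0..1} (G e)) {1..exp (1/e)}"
    using e by (intro has_integral_mult_right) simp
  then have "(action lam f has_integral - 1 / e * integral {0..1} (G e)) {1..exp (1/e)}"
    by (rule has_integral_eq[rotated]) (simp add: act)
  then show ?thesis
    using smooth_f f0 e by (intro exI[of _ f] exI[of _ "1::real"] exI[of _ "exp (1/e)"] exI conjI) (auto intro: mult_neg_pos divide_neg_pos)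
qed


text \<open>A small bump on top of a wide plateau: on the plateau the leading term is \<open>f''\<^sup>2 > 0\<close>, and the
  contribution of the two ends vanishes as the plateau is stretched.\<close>

lemma action_pos_exists:
  "\<exists>f a b I. smooth f \<and> (\<forall>x. x \<notin> {a..b} \<longrightarrow> f x = 0) \<and>
    (action lam f has_integral I) {a..b} \<and> I > 0"
proof -
  have cont: "continuous_on A bump" "continuous_on A (deriv bump)" "continuous_on A (deriv (deriv bump))" for A
    by (intro smooth_continuous_on smooth_deriv smooth_bump)+
  have snd: "continuous_on A (\<lambda>p. h (snd p))" if "continuous_on UNIV h" for A :: "(real \<times> real) set" and h :: "real \<Rightarrow> real"
    using continuous_on_compose2[OF that continuous_on_snd[OF continuous_on_id]] by simp
  have bump0: "bump x = 0" "deriv bump x = 0" "deriv (deriv bump) x = 0" if "x \<notin> {0..1}" for x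
    using higher_deriv_vanishes[of 0 1 bump x 1] higher_deriv_vanishes[of 0 1 bump x 2] bump_eq_0 that
    by (simp_all add: numeral_2_eq_2)
  \<comment> \<open>\<open>e ^ 2 * G e\<close> is the integrand of \<open>1 + e * bump\<close>;
    \<open>G 0\<close> is the square of the second derivative of the bump.\<close>
  define G where "G e t = (1 + e * bump t)\<^sup>2 * (deriv (deriv bump) t)\<^sup>2 - lam * e\<^sup>2 * (deriv bump t) ^ 4" for e t
  have "continuous_on ({0..1} \<times> {0..1}) (\<lambda>p. G (fst p) (snd p))"
    unfolding G_def by (intro continuous_intros snd cont)
  moreover have "integral {0..1} (G 0) > 0"
  proof -
    \<comment> \<open>With zero second derivative the bump would be constant, since its slope
      vanishes at 2; but it is positive at 1/2 and zero at 2.\<close>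
    obtain c where c: "deriv (deriv bump) c \<noteq> 0"
    proof (rule ccontr)
      assume "\<not> thesis"
      then have "deriv (deriv bump) x = 0" for x using that by blast
      then have "deriv bump x = deriv bump 2" for x
        using smooth_has_deriv[OF smooth_deriv[OF smooth_bump]] DERIV_isconst_all[of "deriv bump" x 2] by metis
      then have "deriv bump x = 0" for x using bump0[of 2] by simp
      then have "bump (1/2) = bump 2"
        using smooth_has_deriv[OF smooth_bump] DERIV_isconst_all[of bump "1/2" 2] by metis
      then show False using bump_half bump_eq_0[of 2] by simp
    qed
    then have "c \<in> {0..1}" using bump0 by blast
    moreover have "continuous_on {0..1} (G 0)"
      unfolding G_def[abs_def] by (intro continuous_intros cont)
    ultimately show ?thesis
      using c by (intro integral_pos_continuous[where c = c]) (auto simp: G_def)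
  qed
  ultimately obtain e where e: "e > 0" "integral {0..1} (G e) > 0"
    using eventually_integral_pos[of G] by (auto simp: case_prod_beta)
  define \<kappa> where "\<kappa> = e\<^sup>2 * integral {0..1} (G e)"
  have \<kappa>: "\<kappa> > 0" using e by (simp add: \<kappa>_def)
  obtain st where st: "smooth st" "\<And>x. x \<le> 0 \<Longrightarrow> st x = 0" "\<And>x. x \<ge> 1 \<Longrightarrow> st x = 1"
    using smooth_step_exists by blast
  define pl where "pl x = st (x + 2) - st (x - 1)" for x
  have smooth_pl: "smooth pl"
    using smooth_diff[OF smooth_compose_affine[OF st(1), of 1 2] smooth_compose_affine[OF st(1), of 1 "-1"]]
    by (simp add: pl_def[abs_def])
  have pl: "pl x = 0" if "x \<notin> {-2..2}" for x using that st by (auto simp: pl_def)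
  have pl1: "pl x = 1" if "x \<in> {-1..1}" for x using that st by (auto simp: pl_def)
  define A where "A = integral {-2..2} (action lam pl)"
  \<comment> \<open>\<open>r < 1\<close> keeps \<open>{0..1}\<close> inside the stretched plateau,
    and \<open>r ^ 3 \<le> r\<close> turns the second bound into
    \<open>r ^ 3 * \<bar>A\<bar> < \<kappa>\<close>, so the bump outweighs the ends.\<close>
  define r where "r = min (1/2) (\<kappa> / (\<bar>A\<bar> + 1))"
  have r: "0 < r" "r < 1" using \<kappa> by (auto simp: r_def)
  define g where "g x = pl (r * x)" for x
  have smooth_g: "smooth g" using smooth_compose_affine[OF smooth_pl, of r 0] by (simp add: g_def[abs_def])
  have g1: "g x = 1 \<and> deriv g x = 0 \<and> deriv (deriv g) x = 0" if "x \<in> {0..1}" for x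
  proof -
    have "g y = 1" if "y \<in> {-1/r<..<1/r}" for y
      unfolding g_def using that r by (intro pl1) (auto simp: field_simps)
    moreover have "1 < 1 / r" using r by simp
    then have "-1/r < x" "x < 1/r" using that unfolding atLeastAtMost_iff by linarith+
    then have "x \<in> {-1/r<..<1/r}" by simp
    ultimately show ?thesis
      using higher_deriv_cong_open[of "{-1/r<..<1/r}" g "\<lambda>_. 1" x 1]
        higher_deriv_cong_open[of "{-1/r<..<1/r}" g "\<lambda>_. 1" x 2]
      by (simp add: numeral_2_eq_2)
  qed
  define f where "f x = g x + e * bump x" for x
  have smooth_f: "smooth f" unfolding f_def[abs_def] by (intro smooth_add smooth_g smooth_mult smooth_const smooth_bump)
  have df: "deriv f = (\<lambda>x. deriv g x + e * deriv bump x)"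
    "deriv (deriv f) = (\<lambda>x. deriv (deriv g) x + e * deriv (deriv bump) x)"
    by (simp_all add: f_def[abs_def] deriv_add_smooth deriv_cmult_smooth smooth_g smooth_bump smooth_mult
        smooth_const smooth_deriv)
  have act: "action lam f x = action lam g x + (if x \<in> {0..1} then e\<^sup>2 * G e x else 0)" for x
  proof (cases "x \<in> {0..1}")
    case True
    then show ?thesis
      unfolding action_def unfolding df(2) unfolding df(1) unfolding f_def using g1[OF True]
      by (simp add: G_def algebra_simps power2_eq_square power4_eq_xxxx)
  next
    case False
    then show ?thesis unfolding action_def unfolding df(2) unfolding df(1) unfolding f_def by (simp only: bump0[OF False]) simp
  qed
  have "(action lam pl has_integral A) {-2..2}"
    unfolding A_def by (intro integrable_integral integrable_continuous_real continuous_on_action smooth_pl)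
  from action_affine_has_integral[OF smooth_pl this r(1), of 0]
  have 1: "(action lam g has_integral r ^ 3 * A) {-2/r..2/r}" by (simp add: g_def[abs_def])
  have "((\<lambda>x. e\<^sup>2 * G e x) has_integral \<kappa>) {0..1}"
    unfolding \<kappa>_def G_def[abs_def]
    by (intro has_integral_mult_right integrable_integral integrable_continuous_real continuous_intros cont)
  moreover have "2 < 2 / r" using r by (simp add: field_simps)
  then have "- 2 / r \<le> 0" "1 \<le> 2 / r" by linarith+
  then have "{0..1} \<subseteq> {-2/r..2/r}" by (simp only: atLeastatMost_subset_iff) simp
  ultimately have 2: "((\<lambda>x. if x \<in> {0..1} then e\<^sup>2 * G e x else 0) has_integral \<kappa>) {-2/r..2/r}"
    by (simp only: has_integral_restrict)
  have "(action lam f has_integral r ^ 3 * A + \<kappa>) {-2/r..2/r}"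
    using has_integral_add[OF 1 2] by (simp only: act[symmetric])
  moreover have "r ^ 3 * A + \<kappa> > 0"
  proof -
    have "r ^ 3 \<le> r ^ 1" using r by (intro power_decreasing) auto
    then have "r ^ 3 * \<bar>A\<bar> \<le> r * \<bar>A\<bar>" by (intro mult_right_mono) auto
    also have "\<dots> \<le> \<kappa> / (\<bar>A\<bar> + 1) * \<bar>A\<bar>" by (intro mult_right_mono) (auto simp: r_def)
    also have "\<dots> < \<kappa>" using \<kappa> by (simp add: field_simps)
    finally have "\<bar>r ^ 3 * A\<bar> < \<kappa>" using r by (simp add: abs_mult)
    then show ?thesis by linarith
  qed
  moreover have "f x = 0" if "x \<notin> {-2/r..2/r}" for x
  proof -
    have "r * x \<notin> {-2..2}" using that r by (auto simp: field_simps)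
    moreover have "x \<notin> {0..1}" using that \<open>{0..1} \<subseteq> {-2/r..2/r}\<close> by blast
    ultimately show ?thesis by (simp add: f_def g_def pl bump_eq_0)
  qed
  ultimately show ?thesis using smooth_f by blast
qed

section \<open>Controllability\<close>

lemma higher_deriv_bounded:
  assumes "smooth f"
  shows "\<exists>C\<ge>0. \<forall>k\<le>m. \<forall>t\<in>{a..b}. \<bar>(deriv ^^ k) f t\<bar> \<le> C"
proof (induction m)
  case (Suc m)
  then obtain C where C: "C \<ge> 0" "\<And>k t. k \<le> m \<Longrightarrow> t \<in> {a..b} \<Longrightarrow> \<bar>(deriv ^^ k) f t\<bar> \<le> C" by blast
  have "compact ((deriv ^^ Suc m) f ` {a..b})"
    using assms by (intro compact_continuous_image smooth_continuous_on smooth_higher_deriv) auto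
  then obtain D where D: "\<And>t. t \<in> {a..b} \<Longrightarrow> \<bar>(deriv ^^ Suc m) f t\<bar> \<le> D"
    using compact_imp_bounded[THEN bounded_iff[THEN iffD1]] by (metis imageI real_norm_def)
  have "\<bar>(deriv ^^ k) f t\<bar> \<le> max C D" if "k \<le> Suc m" "t \<in> {a..b}" for k t
    using C(2)[of k t] D[of t] that by (cases "k = Suc m") (auto simp: le_max_iff_disj)
  then show ?case using C(1) by (intro exI[of _ "max C D"]) auto
next
  case 0
  have "compact (f ` {a..b})"
    using assms by (intro compact_continuous_image smooth_continuous_on) auto
  then obtain D where D: "\<And>t. t \<in> {a..b} \<Longrightarrow> \<bar>f t\<bar> \<le> D"
    using compact_imp_bounded[THEN bounded_iff[THEN iffD1]] by (metis imageI real_norm_def)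
  then show ?case by (intro exI[of _ "max 0 D"]) (auto simp: le_max_iff_disj)
qed

lemma action_eq_0:
  assumes "\<And>x. x \<notin> {a..b} \<Longrightarrow> f x = 0" "x \<notin> {a..b}"
  shows "action lam f x = 0"
  using higher_deriv_vanishes[of a b f x 1] assms by (simp add: action_def)

text \<open>An affine change of variable moves the support into \<open>{T/6..T/3}\<close>, clear of
  both ends and of the second half of the time interval, and keeps the sign.\<close>

lemma action_rescale:
  assumes f: "smooth f" "\<And>x. x \<notin> {a..b} \<Longrightarrow> f x = 0" "(action lam f has_integral I) {a..b}"
    and "I \<noteq> 0" "T > 0"
  shows "\<exists>g J. smooth g \<and> (\<forall>x. x \<notin> {T/6..T/3} \<longrightarrow> g x = 0) \<and> (action lam g has_integral J) {0..T} \<and>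
    sgn J = sgn I"
proof -
  have "a < b"
  proof (rule ccontr)
    assume "\<not> a < b"
    then have "negligible {a..b}" by (cases "a = b") auto
    then have "(action lam f has_integral 0) {a..b}" by (rule has_integral_negligible) auto
    then show False using f(3) \<open>I \<noteq> 0\<close> has_integral_unique by blast
  qed
  \<comment> \<open>The map \<open>p * x + q\<close> sends \<open>{T/6..T/3}\<close>, of length
    \<open>T / 6\<close>, onto \<open>{a..b}\<close>.\<close>
  define p where "p = (b - a) * 6 / T"
  define q where "q = a - p * (T / 6)"
  have p: "p > 0" using \<open>a < b\<close> \<open>T > 0\<close> by (simp add: p_def)
  have ends: "(a - q) / p = T/6" "(b - q) / p = T/3"
    using p \<open>a < b\<close> \<open>T > 0\<close> by (simp_all add: q_def p_def field_simps)
  define g where "g x = f (p * x + q)" for x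
  have g0: "g x = 0" if "x \<notin> {T/6..T/3}" for x
  proof -
    have "x < (a - q) / p \<or> x > (b - q) / p" using that unfolding ends by auto
    then have "p * x + q \<notin> {a..b}" using p by (auto simp: field_simps)
    then show ?thesis by (simp add: g_def f(2))
  qed
  have "(action lam g has_integral p ^ 3 * I) {T/6..T/3}"
    using action_affine_has_integral[OF f(1,3) p, of q] by (simp add: ends g_def[abs_def])
  then have "(action lam g has_integral p ^ 3 * I) {0..T}"
  proof (rule has_integral_on_superset)
    show "action lam g x = 0" if "x \<notin> {T/6..T/3}" for x using action_eq_0[OF g0 that] .
    show "{T/6..T/3} \<subseteq> {0..T}" using \<open>T > 0\<close> by auto
  qed
  moreover have "smooth g" unfolding g_def[abs_def] by (rule smooth_compose_affine[OF f(1)])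
  moreover have "sgn (p ^ 3 * I) = sgn I" using p by (simp add: sgn_mult)
  ultimately show ?thesis using g0 by blast
qed

text \<open>The functional is homogeneous of degree 4, so the amplitude
  \<open>root 4 (z / J)\<close> produces the value \<open>z\<close>. The constant is independent of
  \<open>z\<close>, so the motion and its derivatives shrink with \<open>z\<close>.\<close>

lemma action_scaled:
  assumes g: "smooth g" "\<And>x. x \<notin> S \<Longrightarrow> g x = 0" "(action lam g has_integral J) {0..T}" and "J \<noteq> 0"
  shows "\<exists>C\<ge>0. \<forall>z. z / J \<ge> 0 \<longrightarrow> (\<exists>f. smooth f \<and> (\<forall>x. x \<notin> S \<longrightarrow> f x = 0) \<and>
    (action lam f has_integral z) {0..T} \<and> (\<forall>k\<le>m. \<forall>t\<in>{0..T}. \<bar>(deriv ^^ k) f t\<bar> \<le> C * root 4 \<bar>z\<bar>))"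
proof -
  obtain C where C: "C \<ge> 0" "\<And>k t. k \<le> m \<Longrightarrow> t \<in> {0..T} \<Longrightarrow> \<bar>(deriv ^^ k) g t\<bar> \<le> C"
    using higher_deriv_bounded[OF g(1), of m 0 T] by blast
  define D where "D = root 4 (1 / \<bar>J\<bar>) * C"
  have "\<exists>f. smooth f \<and> (\<forall>x. x \<notin> S \<longrightarrow> f x = 0) \<and> (action lam f has_integral z) {0..T} \<and>
      (\<forall>k\<le>m. \<forall>t\<in>{0..T}. \<bar>(deriv ^^ k) f t\<bar> \<le> D * root 4 \<bar>z\<bar>)" if z: "z / J \<ge> 0" for z
  proof (intro exI[of _ "\<lambda>t. root 4 (z / J) * g t"] conjI allI impI ballI)
    show "smooth (\<lambda>t. root 4 (z / J) * g t)" by (intro smooth_mult smooth_const g(1))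
    show "root 4 (z / J) * g x = 0" if "x \<notin> S" for x using g(2)[OF that] by simp
    have "(action lam (\<lambda>t. root 4 (z / J) * g t)) = (\<lambda>t. z / J * action lam g t)"
      using z by (simp add: fun_eq_iff action_cmult g(1))
    then show "(action lam (\<lambda>t. root 4 (z / J) * g t) has_integral z) {0..T}"
      using has_integral_mult_right[OF g(3), of "z / J"] \<open>J \<noteq> 0\<close> by simp
    fix k t assume k: "k \<le> m" "t \<in> {0..T}"
    have "\<bar>z / J\<bar> = 1 / \<bar>J\<bar> * \<bar>z\<bar>" by simp
    then have "\<bar>root 4 (z / J)\<bar> = root 4 (1 / \<bar>J\<bar>) * root 4 \<bar>z\<bar>"
      by (metis real_root_abs real_root_mult zero_less_numeral)
    then show "\<bar>(deriv ^^ k) (\<lambda>t. root 4 (z / J) * g t) t\<bar> \<le> D * root 4 \<bar>z\<bar>"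
      using mult_left_mono[OF C(2)[OF k], of "root 4 (1 / \<bar>J\<bar>) * root 4 \<bar>z\<bar>"]
      unfolding higher_deriv_cmult[OF g(1)] abs_mult by (simp add: D_def mult_ac)
  qed
  moreover have "D \<ge> 0" using C by (simp add: D_def)
  ultimately show ?thesis by blast
qed

text \<open>The sign of \<open>z\<close> selects the profile, and the larger constant serves
  both.\<close>

lemma action_realize:
  assumes "lam > 1/9" "T > 0"
  shows "\<exists>C\<ge>0. \<forall>z. \<exists>f. smooth f \<and> (\<forall>x. x \<notin> {T/6..T/3} \<longrightarrow> f x = 0) \<and>
    (action lam f has_integral z) {0..T} \<and> (\<forall>k\<le>m. \<forall>t\<in>{0..T}. \<bar>(deriv ^^ k) f t\<bar> \<le> C * root 4 \<bar>z\<bar>)"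
    (is "\<exists>C\<ge>0. \<forall>z. ?P C z")
proof -
  have *: "\<exists>C\<ge>0. \<forall>z. z / s \<ge> 0 \<longrightarrow> ?P C z"
    if f: "smooth f \<and> (\<forall>x. x \<notin> {a..b} \<longrightarrow> f x = 0) \<and> (action lam f has_integral I) {a..b}"
      and I: "I \<noteq> 0" "sgn I = s" for f a b I s
  proof -
    obtain g J where g: "smooth g" "\<And>x. x \<notin> {T/6..T/3} \<Longrightarrow> g x = 0"
      "(action lam g has_integral J) {0..T}" and J: "sgn J = sgn I"
      using action_rescale[of f a b lam I T] f I \<open>T > 0\<close> by blast
    have "J \<noteq> 0" using J I(1) sgn_0_0 by metis
    moreover have "z / J \<ge> 0 \<longleftrightarrow> z / s \<ge> 0" for z
      using J I by (cases "J > 0") (auto simp: sgn_if zero_le_divide_iff split: if_splits)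
    ultimately show ?thesis using action_scaled[where S = "{T/6..T/3}" and m = m, OF g] by auto
  qed
  obtain f a b I where f: "smooth f" "\<forall>x. x \<notin> {a..b} \<longrightarrow> f x = 0" "(action lam f has_integral I) {a..b}" "I > 0"
    using action_pos_exists by blast
  then obtain C where C: "C \<ge> 0" "\<And>z. z / 1 \<ge> 0 \<Longrightarrow> ?P C z" using *[of f a b I 1] by auto
  obtain f a b I where f: "smooth f" "\<forall>x. x \<notin> {a..b} \<longrightarrow> f x = 0" "(action lam f has_integral I) {a..b}" "I < 0"
    using action_neg_exists[OF assms(1)] by blast
  then obtain D where D: "D \<ge> 0" "\<And>z. z / -1 \<ge> 0 \<Longrightarrow> ?P D z" using *[of f a b I "-1"] by auto
  have "?P (max C D) z" for z
  proof -
    have mono: "?P (max C D) z" if "?P E z" "E \<le> max C D" for E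
    proof -
      have "E * root 4 \<bar>z\<bar> \<le> max C D * root 4 \<bar>z\<bar>" using that(2) by (intro mult_right_mono) auto
      then show ?thesis using that(1) by (meson order_trans)
    qed
    show ?thesis
    proof (cases "z \<ge> 0")
      case True then show ?thesis using C(2)[of z] by (intro mono[of C]) auto
    next
      case False then show ?thesis using D(2)[of z] by (intro mono[of D]) auto
    qed
  qed
  then show ?thesis using C(1) by (intro exI[of _ "max C D"]) auto
qed

text \<open>The prescribed second-order Taylor polynomial at \<open>T\<close>, switched on smoothly
  between \<open>T/2\<close> and \<open>3*T/4\<close>. Beyond that the function is quadratic, so the
  control, its third derivative, is zero near \<open>T\<close>.\<close>

lemma linear_motion:
  assumes "T > 0"
  shows "\<exists>C\<ge>0. \<forall>y :: real^4. \<exists>g. smooth g \<and> (\<forall>t<T/2. g t = 0) \<and> (\<forall>t>3*T/4. deriv (deriv (deriv g)) t = 0) \<and>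
    g T = y $ 3 \<and> deriv g T = y $ 2 \<and> deriv (deriv g) T = y $ 1 \<and>
    (\<forall>k\<le>m. \<forall>t\<in>{0..T}. \<bar>(deriv ^^ k) g t\<bar> \<le> C * norm y)"
proof -
  obtain st where st: "smooth st" "\<And>x. x \<le> 0 \<Longrightarrow> st x = 0" "\<And>x. x \<ge> 1 \<Longrightarrow> st x = 1"
    using smooth_step_exists by blast
  define \<sigma> where "\<sigma> t = st (4 / T * t + (- 2))" for t
  have \<sigma>: "\<sigma> t = 0" if "t < T/2" for t
    unfolding \<sigma>_def using that assms by (intro st) (simp add: field_simps)
  have \<sigma>1: "\<sigma> t = 1" if "t > 3*T/4" for t
    unfolding \<sigma>_def using that assms by (intro st) (simp add: field_simps)
  define A where "A i t = \<sigma> t * (t - T) ^ i" for i t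
  have smooth_pow: "smooth (\<lambda>t. (t - T) ^ i)" for i
  proof (induction i)
    case (Suc i)
    then show ?case by (simp, intro smooth_mult smooth_diff smooth_ident smooth_const)
  qed (simp add: smooth_const)
  have smooth_A: "smooth (A i)" for i
    unfolding A_def[abs_def] \<sigma>_def[abs_def]
    by (rule smooth_mult[OF smooth_compose_affine[OF st(1)] smooth_pow])
  have "\<forall>i. \<exists>C\<ge>0. \<forall>k\<le>m. \<forall>t\<in>{0..T}. \<bar>(deriv ^^ k) (A i) t\<bar> \<le> C"
    using higher_deriv_bounded[OF smooth_A] by blast
  then obtain C where C: "\<And>i. C i \<ge> 0" "\<And>i k t. k \<le> m \<Longrightarrow> t \<in> {0..T} \<Longrightarrow> \<bar>(deriv ^^ k) (A i) t\<bar> \<le> C i"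
    by metis
  have "\<exists>g. smooth g \<and> (\<forall>t<T/2. g t = 0) \<and> (\<forall>t>3*T/4. deriv (deriv (deriv g)) t = 0) \<and>
    g T = y $ 3 \<and> deriv g T = y $ 2 \<and> deriv (deriv g) T = y $ 1 \<and>
    (\<forall>k\<le>m. \<forall>t\<in>{0..T}. \<bar>(deriv ^^ k) g t\<bar> \<le> (C 0 + C 1 + C 2) * norm y)" for y :: "real^4"
  proof -
    define g where "g t = y $ 3 * A 0 t + (y $ 2 * A 1 t + y $ 1 / 2 * A 2 t)" for t
    have smooth: "smooth (\<lambda>t. c * A i t)" for c i
      by (intro smooth_mult smooth_const smooth_A)
    have smooth_g: "smooth g"
      unfolding g_def[abs_def] by (intro smooth_add smooth)
    define q where "q t = y $ 3 + y $ 2 * (t - T) + y $ 1 / 2 * (t - T)\<^sup>2" for t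
    have dq: "deriv q = (\<lambda>t. y $ 2 + y $ 1 * (t - T))"
      unfolding q_def[abs_def] by (intro ext DERIV_imp_deriv) (auto intro!: derivative_eq_intros)
    have dq': "deriv (\<lambda>t. y $ 2 + y $ 1 * (t - T)) = (\<lambda>t. y $ 1)"
      by (intro ext DERIV_imp_deriv) (auto intro!: derivative_eq_intros)
    have "(deriv ^^ k) g t = (deriv ^^ k) q t" if "t > 3*T/4" for t k
      by (rule higher_deriv_cong_open[of "{3*T/4<..}"])
        (use that in \<open>auto simp: g_def A_def \<sigma>1 q_def\<close>)
    from this[where k = 0] this[where k = 1] this[where k = 2] this[where k = 3]
    have gq: "g t = q t" "deriv g t = y $ 2 + y $ 1 * (t - T)" "deriv (deriv g) t = y $ 1"
      "deriv (deriv (deriv g)) t = 0" if "t > 3*T/4" for t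
      using that by (simp_all add: dq dq' numeral_2_eq_2 numeral_3_eq_3)
    have "\<bar>(deriv ^^ k) g t\<bar> \<le> (C 0 + C 1 + C 2) * norm y" if "k \<le> m" "t \<in> {0..T}" for k t
    proof -
      have "\<bar>(deriv ^^ k) g t\<bar> \<le> \<bar>y $ 3\<bar> * \<bar>(deriv ^^ k) (A 0) t\<bar>
          + (\<bar>y $ 2\<bar> * \<bar>(deriv ^^ k) (A 1) t\<bar> + \<bar>y $ 1 / 2\<bar> * \<bar>(deriv ^^ k) (A 2) t\<bar>)"
        unfolding g_def[abs_def] higher_deriv_add[OF smooth smooth_add[OF smooth smooth]]
          higher_deriv_add[OF smooth smooth] higher_deriv_cmult[OF smooth_A] abs_mult[symmetric]
        by linarith
      also have "\<dots> \<le> norm y * C 0 + (norm y * C 1 + norm y * C 2)"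
        using component_le_norm_cart[of y 1] component_le_norm_cart[of y 2] component_le_norm_cart[of y 3]
        by (intro add_mono mult_mono C that) auto
      finally show ?thesis by (simp add: algebra_simps)
    qed
    moreover have "3 * T / 4 < T" using assms by simp
    ultimately show ?thesis
      using smooth_g gq(4) gq[of T] \<sigma> by (intro exI[of _ g]) (simp add: q_def g_def A_def)
  qed
  then show ?thesis using C(1) by (intro exI[of _ "C 0 + C 1 + C 2"]) (simp add: add_nonneg_nonneg)
qed

lemma smoothly_STLC_sys:
  assumes "lam > 1/9"
  shows "smoothly_STLC (sys_f0 lam) sys_f1"
  unfolding smoothly_STLC_def Winf0_STLC_def STLC_def
proof (intro allI impI)
  fix m :: nat and T \<rho> :: real assume T: "T > 0" and \<rho>: "\<rho> > 0"
  \<comment> \<open>The order is \<open>m + 3\<close> because the control is the third derivative of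
    the third coordinate.\<close>
  obtain C where C: "C \<ge> 0" and move4: "\<And>z. \<exists>f. smooth f \<and> (\<forall>x. x \<notin> {T/6..T/3} \<longrightarrow> f x = 0) \<and>
    (action lam f has_integral z) {0..T} \<and> (\<forall>k\<le>m+3. \<forall>t\<in>{0..T}. \<bar>(deriv ^^ k) f t\<bar> \<le> C * root 4 \<bar>z\<bar>)"
    using action_realize[OF assms T, of "m + 3"] by blast
  obtain D where D: "D \<ge> 0" and move: "\<And>y :: real^4. \<exists>g. smooth g \<and> (\<forall>t<T/2. g t = 0) \<and>
    (\<forall>t>3*T/4. deriv (deriv (deriv g)) t = 0) \<and>
    g T = y $ 3 \<and> deriv g T = y $ 2 \<and> deriv (deriv g) T = y $ 1 \<and>
    (\<forall>k\<le>m+3. \<forall>t\<in>{0..T}. \<bar>(deriv ^^ k) g t\<bar> \<le> D * norm y)"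
    using linear_motion[OF T, of "m + 3"] by blast
  \<comment> \<open>\<open>K * d ^ 4\<close> bounds what the linear motion adds to
    \<open>x $ 4\<close>. Then \<open>B d\<close> bounds the derivatives of the control up to order
    \<open>m\<close>, and it tends to 0 with \<open>d\<close>.\<close>
  define K where "K = T * ((1 + \<bar>lam\<bar>) * D ^ 4)"
  have K: "K \<ge> 0" using T D by (simp add: K_def)
  define B where "B d = C * root 4 (d + K * d ^ 4) + D * d" for d
  have "((\<lambda>d. (real m + 1) * B d) \<longlongrightarrow> (real m + 1) * (C * root 4 (0 + K * 0 ^ 4) + D * 0)) (at_right 0)"
    unfolding B_def by (intro tendsto_intros)
  then have "eventually (\<lambda>d. (real m + 1) * B d < \<rho>) (at_right 0)"
    by (rule order_tendstoD) (use \<rho> in simp)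
  then have "eventually (\<lambda>d. (real m + 1) * B d < \<rho> \<and> d > 0) (at_right 0)"
    using eventually_at_right_less[of 0] by (rule eventually_conj)
  then obtain d where d: "(real m + 1) * B d < \<rho>" "d > 0"
    using eventually_happens'[OF trivial_limit_at_right_real] by blast
  show "\<exists>\<delta>>0. \<forall>xs\<in>ball 0 \<delta>. \<exists>u\<in>Winf0 m T. Winf_norm m T u \<le> ereal \<rho> \<and>
      (\<exists>x. is_solution (sys_f0 lam) sys_f1 T u x \<and> x T = xs)"
  proof (intro exI[of _ d] conjI ballI d(2))
    fix y :: "real^4" assume "y \<in> ball 0 d"
    then have y: "norm y \<le> d" by simp
    obtain g where g: "smooth g" "\<And>t. t < T/2 \<Longrightarrow> g t = 0" "\<And>t. t > 3*T/4 \<Longrightarrow> deriv (deriv (deriv g)) t = 0"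
      "g T = y $ 3" "deriv g T = y $ 2" "deriv (deriv g) T = y $ 1"
      and g_bound: "\<And>k t. k \<le> m+3 \<Longrightarrow> t \<in> {0..T} \<Longrightarrow> \<bar>(deriv ^^ k) g t\<bar> \<le> D * norm y"
      using move[of y] by blast
    define h where "h = integral {0..T} (action lam g)"
    have h: "(action lam g has_integral h) {0..T}"
      unfolding h_def using g by (intro integrable_integral integrable_continuous_real continuous_on_action)
    have "\<bar>h\<bar> \<le> K * norm y ^ 4"
    proof -
      have "norm (action lam g t) \<le> (1 + \<bar>lam\<bar>) * (D * norm y) ^ 4" if "t \<in> {0..T}" for t
      proof -
        have "\<bar>g t\<bar> \<le> D * norm y" "\<bar>deriv g t\<bar> \<le> D * norm y" "\<bar>deriv (deriv g) t\<bar> \<le> D * norm y"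
          using g_bound[of 0 t] g_bound[of 1 t] g_bound[of 2 t] that by (simp_all add: numeral_2_eq_2)
        then have "\<bar>deriv (deriv g) t\<bar>\<^sup>2 * \<bar>g t\<bar>\<^sup>2 \<le> (D * norm y)\<^sup>2 * (D * norm y)\<^sup>2"
          "\<bar>lam\<bar> * \<bar>deriv g t\<bar> ^ 4 \<le> \<bar>lam\<bar> * (D * norm y) ^ 4"
          by (intro mult_mono power_mono mult_left_mono; simp)+
        then show ?thesis
          unfolding action_def real_norm_def
          by (intro order_trans[OF abs_triangle_ineq4])
            (simp add: abs_mult power_abs algebra_simps flip: power_add)
      qed
      then have "norm h \<le> (1 + \<bar>lam\<bar>) * (D * norm y) ^ 4 * Henstock_Kurzweil_Integration.content {0..T}"
        using D by (intro has_integral_bound_real[OF _ finite.emptyI h]) auto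
      then show ?thesis using T by (simp add: K_def power_mult_distrib mult_ac)
    qed
    also have "\<dots> \<le> K * d ^ 4" using K y by (intro mult_left_mono power_mono) auto
    finally have h_bound: "\<bar>h\<bar> \<le> K * d ^ 4" .
    \<comment> \<open>The linear motion alone adds \<open>h\<close> to the fourth coordinate; the
      first half has to supply the difference.\<close>
    define z where "z = y $ 4 - h"
    have "\<bar>z\<bar> \<le> d + K * d ^ 4"
      using h_bound component_le_norm_cart[of y 4] y by (simp add: z_def)
    then have root_bound: "root 4 \<bar>z\<bar> \<le> root 4 (d + K * d ^ 4)" by simp
    obtain f where f: "smooth f" "\<And>t. t \<notin> {T/6..T/3} \<Longrightarrow> f t = 0" "(action lam f has_integral z) {0..T}"
      and f_bound: "\<And>k t. k \<le> m+3 \<Longrightarrow> t \<in> {0..T} \<Longrightarrow> \<bar>(deriv ^^ k) f t\<bar> \<le> C * root 4 \<bar>z\<bar>"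
      using move4[of z] by blast
    have f0: "f t = 0 \<and> deriv f t = 0 \<and> deriv (deriv f) t = 0 \<and> deriv (deriv (deriv f)) t = 0"
      if "t \<notin> {T/6..T/3}" for t
      using higher_deriv_vanishes[of "T/6" "T/3" f t 1] higher_deriv_vanishes[of "T/6" "T/3" f t 2]
        higher_deriv_vanishes[of "T/6" "T/3" f t 3] f(2) that
      by (simp add: numeral_2_eq_2 numeral_3_eq_3)
    have g0: "g t = 0 \<and> deriv g t = 0 \<and> deriv (deriv g) t = 0 \<and> deriv (deriv (deriv g)) t = 0"
      if "t < T/2" for t
      using higher_deriv_cong_open[of "{..<T/2}" g "\<lambda>_. 0" t 1] higher_deriv_cong_open[of "{..<T/2}" g "\<lambda>_. 0" t 2]
        higher_deriv_cong_open[of "{..<T/2}" g "\<lambda>_. 0" t 3] g(2) that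
      by (simp add: numeral_2_eq_2 numeral_3_eq_3)
    define s where "s t = f t + g t" for t
    have smooth_s: "smooth s" unfolding s_def[abs_def] by (rule smooth_add[OF f(1) g(1)])
    have ds: "(deriv ^^ k) s = (\<lambda>t. (deriv ^^ k) f t + (deriv ^^ k) g t)" for k
      unfolding s_def[abs_def] by (rule higher_deriv_add[OF f(1) g(1)])
    have ds': "deriv s = (\<lambda>t. deriv f t + deriv g t)"
      "deriv (\<lambda>t. deriv f t + deriv g t) = (\<lambda>t. deriv (deriv f) t + deriv (deriv g) t)"
      "deriv (\<lambda>t. deriv (deriv f) t + deriv (deriv g) t)
        = (\<lambda>t. deriv (deriv (deriv f)) t + deriv (deriv (deriv g)) t)"
      unfolding s_def[abs_def] by (intro deriv_add_smooth smooth_deriv f(1) g(1))+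
    define u where "u = deriv (deriv (deriv s))"
    have u_deriv: "(deriv ^^ k) u = (deriv ^^ (k + 3)) s" for k
      by (simp only: u_def numeral_3_eq_3 funpow_add comp_apply funpow.simps id_apply)
    have u0: "u t = 0" if "t \<notin> {T/6..3*T/4}" for t
    proof -
      \<comment> \<open>Outside this range \<open>f\<close> vanishes, and \<open>g\<close> either
        vanishes or has zero third derivative.\<close>
      have "t \<notin> {T/6..T/3}" "t < T/2 \<or> t > 3*T/4" using that T by auto
      then show ?thesis using f0[of t] g0[of t] g(3)[of t] by (auto simp: u_def ds')
    qed
    have u_bound: "\<bar>(deriv ^^ k) u t\<bar> \<le> B d" if "k \<le> m" "t \<in> {0<..<T}" for k t
    proof -
      have "\<bar>(deriv ^^ k) u t\<bar> \<le> C * root 4 \<bar>z\<bar> + D * norm y"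
        unfolding u_deriv ds using that
        by (intro order_trans[OF abs_triangle_ineq] add_mono f_bound g_bound) auto
      also have "\<dots> \<le> B d"
        unfolding B_def using C D y root_bound by (intro add_mono mult_left_mono) auto
      finally show ?thesis .
    qed
    have "smooth u" unfolding u_def by (intro smooth_deriv smooth_s)
    then have u: "u \<in> Winf0 m T" "Winf_norm m T u \<le> ereal ((real m + 1) * B d)"
      using Winf0_smooth[where a = "T/6" and b = "3*T/4" and m = m, OF _ u0 _ _ T u_bound] T by auto
    let ?x = "\<lambda>t. vector [deriv (deriv s) t, deriv s t, s t, integral {0..t} (action lam s)] :: real^4"
    have "is_solution (sys_f0 lam) sys_f1 T u ?x"
      unfolding u_def using T f0[of 0] g0[of 0]
      by (intro is_solution_smooth smooth_s) (auto simp: s_def ds')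
    moreover have "?x T = y"
    proof -
      \<comment> \<open>\<open>f\<close> is supported before \<open>T/3\<close> and \<open>g\<close>
        from \<open>T/2\<close> on, so no cross terms arise.\<close>
      have "action lam s t = action lam f t + action lam g t" for t
        unfolding s_def[abs_def]
        by (rule action_add_disjoint[OF f(1) g(1)]) (use f0[of t] g0[of t] T in fastforce)
      then have "action lam s = (\<lambda>t. action lam f t + action lam g t)" by (rule ext)
      then have "(action lam s has_integral z + h) {0..T}"
        using has_integral_add[OF f(3) h] by simp
      then have "integral {0..T} (action lam s) = y $ 4" by (simp add: integral_unique z_def)
      moreover have "deriv (deriv s) T = y $ 1" "deriv s T = y $ 2" "s T = y $ 3"
        using f0[of T] g T by (simp_all add: ds' s_def)
      ultimately show ?thesis by (simp add: vec4_eq_iff vector_def)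
    qed
    moreover have "Winf_norm m T u \<le> ereal \<rho>"
      using u(2) d(1) by (meson ereal_less_eq(3) less_imp_le order_trans)
    ultimately show "\<exists>u\<in>Winf0 m T. Winf_norm m T u \<le> ereal \<rho> \<and>
        (\<exists>x. is_solution (sys_f0 lam) sys_f1 T u x \<and> x T = y)"
      using u(1) by blast
  qed
qed

theorem proposition1p21:
  shows "(\<exists>lams>0. (\<forall>lam::real. lam \<le> lams \<longrightarrow> \<not> Wm1_STLC (sys_f0 lam) sys_f1) \<and>
                 (\<forall>lam::real. lam > lams \<longrightarrow> smoothly_STLC (sys_f0 lam) sys_f1)) \<and>
         {X1, M 1, M 2, Q 1 3 3, Q 2 2 2} \<subseteq> Bstar \<and>
         (\<forall>lam::real.
            (\<forall>b\<in>Bstar. eval_br (sys_f0 lam) sys_f1 b 0 \<noteq> 0 \<longrightarrow>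
               b \<in> {X1, M 1, M 2, Q 1 3 3, Q 2 2 2}) \<and>
            eval_br (sys_f0 lam) sys_f1 X1 0 = axis 1 1 \<and>
            eval_br (sys_f0 lam) sys_f1 (M 1) 0 = axis 2 1 \<and>
            eval_br (sys_f0 lam) sys_f1 (M 2) 0 = axis 3 1 \<and>
            eval_br (sys_f0 lam) sys_f1 (Q 1 3 3) 0 = 4 *\<^sub>R axis 4 1 \<and>
            eval_br (sys_f0 lam) sys_f1 (Q 2 2 2) 0 = (- 24 * lam) *\<^sub>R axis 4 1)"
proof (intro conjI allI ballI impI)
  show "\<exists>lams>0. (\<forall>lam::real. lam \<le> lams \<longrightarrow> \<not> Wm1_STLC (sys_f0 lam) sys_f1) \<and>
      (\<forall>lam::real. lam > lams \<longrightarrow> smoothly_STLC (sys_f0 lam) sys_f1)"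
    using not_Wm1_STLC smoothly_STLC_sys by (intro exI[of _ "1/9"]) auto
qed (use listed_in_Bstar eval_nonzero_cases eval_listed in blast)+

end
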